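(* For every set of formulas $\Gamma$ and every formula $\phi$ of the language of $\mathsf{MS^2IC}$, we have $\Gamma\vdash_{\mathsf{MS^2IC}_u}\phi$ if and only if $\Gamma\vDash_{\mathsf{UMDV}}\phi$, where $\mathsf{UMDV}$ is the class of upper continuous modal de Vries algebras.
   Context: Language: propositional variables, constants $\top,\bot$, the classical connectives $\neg,\wedge,\vee,\to,\leftrightarrow$, a binary connective $\rightsquigarrow$ (strict implication) and a unary modality $\Box$; $\Diamond\phi$ abbreviates $\neg\Box\neg\phi$ and $[\forall]\phi$ abbreviates $\top\rightsquigarrow\phi$. $\mathsf{MS^2IC}$ is the deductive system whose theorems form the least set containing all substitution instances of classical tautologies and of the axioms (A1) $(\bot\rightsquigarrow\phi)\wedge(\phi\rightsquigarrow\top)$; (A2) $((\phi\vee\psi)\rightsquigarrow\chi)\leftrightarrow((\phi\rightsquigarrow\chi)\wedge(\psi\rightsquigarrow\chi))$; (A3) $(\phi\rightsquigarrow(\psi\wedge\chi))\leftrightarrow((\phi\rightsquigarrow\psi)\wedge(\phi\rightsquigarrow\chi))$; (A4) $(\phi\rightsquigarrow\psi)\to(\phi\to\psi)$; (A5) $(\phi\rightsquigarrow\psi)\leftrightarrow(\neg\psi\rightsquigarrow\neg\phi)$; (A8) $[\forall]\phi\to[\forall][\forall]\phi$; (A9) $\neg[\forall]\phi\to[\forall]\neg[\forall]\phi$; (A10) $(\phi\rightsquigarrow\psi)\leftrightarrow[\forall](\phi\rightsquigarrow\psi)$; (A11) $[\forall]\phi\to(\neg[\forall]\phi\rightsquigarrow\bot)$;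 (K) $\Box(\phi\to\psi)\to(\Box\phi\to\Box\psi)$; (Add) $(\phi\rightsquigarrow\psi)\to(\Box\phi\rightsquigarrow\Box\psi)$; and closed under modus ponens, (R) from $\phi$ infer $[\forall]\phi$, and (N) from $\phi$ infer $\Box\phi$. $\mathsf{MS^2IC}_u$ is obtained by additionally closing under the following rules, in each of which $p$ is a propositional variable not occurring in $\phi,\psi,\chi$: ($\rho6$) from $(\phi\rightsquigarrow p)\wedge(p\rightsquigarrow\psi)\to\chi$ infer $(\phi\rightsquigarrow\psi)\to\chi$; ($\rho7$) from $(p\rightsquigarrow\phi)\wedge p\to\chi$ infer $\phi\to\chi$; (UC) from $(p\rightsquigarrow\phi)\wedge\Box p\to\psi$ infer $\Box\phi\to\psi$. $\Gamma\vdash_{\mathsf{MS^2IC}_u}\phi$ means there are $\gamma_1,\dots,\gamma_n\in\Gamma$ with $[\forall](\gamma_1\wedge\dots\wedge\gamma_n)\to\phi$ a theorem of $\mathsf{MS^2IC}_u$. A contact algebra is $(B,\prec)$ with $B$ a Boolean algebra and $\prec$ a binary relation such that: $0\prec0$, $1\prec1$; $a\prec b,a\prec c\Rightarrow a\prec b\wedge c$; $a\prec c,b\prec c\Rightarrow a\vee b\prec c$; $a\le b\prec c\le d\Rightarrow a\prec d$; $a\prec b\Rightarrow a\le b$; $a\prec b\Rightarrow\neg b\prec\neg a$. It is compingent if moreover $a\prec b$ implies $a\prec c\prec b$ for some $c$, and $a\ne0$ implies $b\prec a$ for some $b\ne0$; a de Vries algebra is a compingent algebra whose Boolean algebra is complete.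 An operator $\Diamond:B\to B$ is de Vries additive if $\Diamond0=0$ and $a_1\prec b_1$, $a_2\prec b_2$ imply $\Diamond(a_1\vee a_2)\prec\Diamond b_1\vee\Diamond b_2$. A modal contact (resp. compingent, de Vries) algebra is $(B,\prec,\Diamond)$ with $(B,\prec)$ contact (resp. compingent, de Vries) and $\Diamond$ de Vries additive. $\Diamond$ is upper continuous if for each $a$ the meet of $\{\Diamond b: a\prec b\}$ exists and equals $\Diamond a$. A valuation $v$ on a modal contact algebra sends variables to elements of $B$ and extends with Boolean operations, $v(\phi\rightsquigarrow\psi)=1$ if $v(\phi)\prec v(\psi)$ and $0$ otherwise, and $v(\Box\phi)=\neg\Diamond\neg v(\phi)$. For a class $\mathsf K$, $\Gamma\vDash_{\mathsf K}\phi$ means: for all $\mathbf B\in\mathsf K$ and valuations $v$ on $\mathbf B$, if $v(\gamma)=1$ for all $\gamma\in\Gamma$ then $v(\phi)=1$.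
   Formalization: The calculus also has the rule: from φ↔φ' and ψ↔ψ' infer (φ⇝ψ)↔(φ'⇝ψ'). Without it the listed axioms and rules do not derive [∀]p→[∀]¬¬p, which is valid in all contact algebras, so completeness would fail. *)

theory Defs
  imports "HOL-Algebra.Complete_Lattice"
begin

section \<open>Syntax\<close>

datatype fm =
    Var nat
  | Top  (\<open>\<^bold>\<top>\<close>)
  | Bot  (\<open>\<^bold>\<bottom>\<close>)
  | Neg fm  (\<open>\<^bold>\<not> _\<close> [70] 70)
  | Conj fm fm  (infixr \<open>\<^bold>\<and>\<close> 65)
  | Disj fm fm  (infixr \<open>\<^bold>\<or>\<close> 60)
  | Imp fm fm  (infixr \<open>\<^bold>\<rightarrow>\<close> 50)
  | Iff fm fm  (infixr \<open>\<^bold>\<leftrightarrow>\<close> 45)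
  | SImp fm fm  (infix \<open>\<leadsto>\<close> 55)
  | Box fm  (\<open>\<^bold>\<box> _\<close> [70] 70)

abbreviation Univ :: "fm \<Rightarrow> fm"  (\<open>\<^bold>\<forall> _\<close> [70] 70)
  where "\<^bold>\<forall> \<phi> \<equiv> \<^bold>\<top> \<leadsto> \<phi>"

primrec vars :: "fm \<Rightarrow> nat set" where
  "vars (Var p) = {p}"
| "vars \<^bold>\<top> = {}"
| "vars \<^bold>\<bottom> = {}"
| "vars (\<^bold>\<not> \<phi>) = vars \<phi>"
| "vars (\<phi> \<^bold>\<and> \<psi>) = vars \<phi> \<union> vars \<psi>"
| "vars (\<phi> \<^bold>\<or> \<psi>) = vars \<phi> \<union> vars \<psi>"
| "vars (\<phi> \<^bold>\<rightarrow> \<psi>) = vars \<phi> \<union> vars \<psi>"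
| "vars (\<phi> \<^bold>\<leftrightarrow> \<psi>) = vars \<phi> \<union> vars \<psi>"
| "vars (\<phi> \<leadsto> \<psi>) = vars \<phi> \<union> vars \<psi>"
| "vars (\<^bold>\<box> \<phi>) = vars \<phi>"

primrec subst :: "(nat \<Rightarrow> fm) \<Rightarrow> fm \<Rightarrow> fm" where
  "subst \<sigma> (Var p) = \<sigma> p"
| "subst \<sigma> \<^bold>\<top> = \<^bold>\<top>"
| "subst \<sigma> \<^bold>\<bottom> = \<^bold>\<bottom>"
| "subst \<sigma> (\<^bold>\<not> \<phi>) = \<^bold>\<not> subst \<sigma> \<phi>"
| "subst \<sigma> (\<phi> \<^bold>\<and> \<psi>) = subst \<sigma> \<phi> \<^bold>\<and> subst \<sigma> \<psi>"
| "subst \<sigma> (\<phi> \<^bold>\<or> \<psi>) = subst \<sigma> \<phi> \<^bold>\<or> subst \<sigma> \<psi>"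
| "subst \<sigma> (\<phi> \<^bold>\<rightarrow> \<psi>) = (subst \<sigma> \<phi> \<^bold>\<rightarrow> subst \<sigma> \<psi>)"
| "subst \<sigma> (\<phi> \<^bold>\<leftrightarrow> \<psi>) = (subst \<sigma> \<phi> \<^bold>\<leftrightarrow> subst \<sigma> \<psi>)"
| "subst \<sigma> (\<phi> \<leadsto> \<psi>) = (subst \<sigma> \<phi> \<leadsto> subst \<sigma> \<psi>)"
| "subst \<sigma> (\<^bold>\<box> \<phi>) = \<^bold>\<box> subst \<sigma> \<phi>"

primrec classical :: "fm \<Rightarrow> bool" where
  "classical (Var p) = True"
| "classical \<^bold>\<top> = True"
| "classical \<^bold>\<bottom> = True"
| "classical (\<^bold>\<not> \<phi>) = classical \<phi>"
| "classical (\<phi> \<^bold>\<and> \<psi>) = (classical \<phi> \<and> classical \<psi>)"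
| "classical (\<phi> \<^bold>\<or> \<psi>) = (classical \<phi> \<and> classical \<psi>)"
| "classical (\<phi> \<^bold>\<rightarrow> \<psi>) = (classical \<phi> \<and> classical \<psi>)"
| "classical (\<phi> \<^bold>\<leftrightarrow> \<psi>) = (classical \<phi> \<and> classical \<psi>)"
| "classical (\<phi> \<leadsto> \<psi>) = False"
| "classical (\<^bold>\<box> \<phi>) = False"

text \<open>Truth tables; the values in the last two clauses are junk, as \<open>truth\<close> is only used on
  classical formulas.\<close>

primrec truth :: "(nat \<Rightarrow> bool) \<Rightarrow> fm \<Rightarrow> bool" where
  "truth e (Var p) = e p"
| "truth e \<^bold>\<top> = True"
| "truth e \<^bold>\<bottom> = False"
| "truth e (\<^bold>\<not> \<phi>) = (\<not> truth e \<phi>)"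
| "truth e (\<phi> \<^bold>\<and> \<psi>) = (truth e \<phi> \<and> truth e \<psi>)"
| "truth e (\<phi> \<^bold>\<or> \<psi>) = (truth e \<phi> \<or> truth e \<psi>)"
| "truth e (\<phi> \<^bold>\<rightarrow> \<psi>) = (truth e \<phi> \<longrightarrow> truth e \<psi>)"
| "truth e (\<phi> \<^bold>\<leftrightarrow> \<psi>) = (truth e \<phi> \<longleftrightarrow> truth e \<psi>)"
| "truth e (\<phi> \<leadsto> \<psi>) = False"
| "truth e (\<^bold>\<box> \<phi>) = False"

definition tautology :: "fm \<Rightarrow> bool"
  where "tautology \<tau> \<longleftrightarrow> classical \<tau> \<and> (\<forall>e. truth e \<tau>)"

section \<open>The calculus\<close>

inductive axiom :: "fm \<Rightarrow> bool" where
  A1: "axiom ((\<^bold>\<bottom> \<leadsto> \<phi>) \<^bold>\<and> (\<phi> \<leadsto> \<^bold>\<top>))"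
| A2: "axiom (((\<phi> \<^bold>\<or> \<psi>) \<leadsto> \<chi>) \<^bold>\<leftrightarrow> ((\<phi> \<leadsto> \<chi>) \<^bold>\<and> (\<psi> \<leadsto> \<chi>)))"
| A3: "axiom ((\<phi> \<leadsto> (\<psi> \<^bold>\<and> \<chi>)) \<^bold>\<leftrightarrow> ((\<phi> \<leadsto> \<psi>) \<^bold>\<and> (\<phi> \<leadsto> \<chi>)))"
| A4: "axiom ((\<phi> \<leadsto> \<psi>) \<^bold>\<rightarrow> (\<phi> \<^bold>\<rightarrow> \<psi>))"
| A5: "axiom ((\<phi> \<leadsto> \<psi>) \<^bold>\<leftrightarrow> (\<^bold>\<not> \<psi> \<leadsto> \<^bold>\<not> \<phi>))"
| A8: "axiom (\<^bold>\<forall> \<phi> \<^bold>\<rightarrow> \<^bold>\<forall> (\<^bold>\<forall> \<phi>))"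
| A9: "axiom (\<^bold>\<not> (\<^bold>\<forall> \<phi>) \<^bold>\<rightarrow> \<^bold>\<forall> (\<^bold>\<not> (\<^bold>\<forall> \<phi>)))"
| A10: "axiom ((\<phi> \<leadsto> \<psi>) \<^bold>\<leftrightarrow> \<^bold>\<forall> (\<phi> \<leadsto> \<psi>))"
| A11: "axiom (\<^bold>\<forall> \<phi> \<^bold>\<rightarrow> (\<^bold>\<not> (\<^bold>\<forall> \<phi>) \<leadsto> \<^bold>\<bottom>))"
| K: "axiom (\<^bold>\<box> (\<phi> \<^bold>\<rightarrow> \<psi>) \<^bold>\<rightarrow> (\<^bold>\<box> \<phi> \<^bold>\<rightarrow> \<^bold>\<box> \<psi>))"
| Add: "axiom ((\<phi> \<leadsto> \<psi>) \<^bold>\<rightarrow> (\<^bold>\<box> \<phi> \<leadsto> \<^bold>\<box> \<psi>))"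

text \<open>
  \<open>RE\<close> makes explicit the convention that provably equivalent formulas may replace each other under
  \<open>\<leadsto>\<close> (for \<open>\<^bold>\<box>\<close> this follows from \<open>N\<close> and \<open>K\<close>). It is not derivable from the other clauses, and
  without it the completeness theorem fails: \<open>\<^bold>\<forall> p \<^bold>\<rightarrow> \<^bold>\<forall> (\<^bold>\<not> \<^bold>\<not> p)\<close> is valid in all contact algebras
  but would not be a theorem. To see this, let \<open>bad\<close> be the least relation with
  \<open>bad \<^bold>\<top> (\<^bold>\<not> \<^bold>\<not> (Var x))\<close> that is closed under \<open>bad \<psi> \<phi> \<Longrightarrow> bad (\<^bold>\<not> \<phi>) (\<^bold>\<not> \<psi>)\<close>, under putting a
  disjunct next to the first argument and a conjunct next to the second. All other
  clauses preserve validity for the two-valued reading in which \<open>\<^bold>\<box> \<phi>\<close> means \<open>\<phi>\<close>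
  and \<open>\<phi> \<leadsto> \<psi>\<close> means \<open>\<phi> \<^bold>\<rightarrow> \<psi>\<close> if \<open>\<not> bad \<phi> \<psi>\<close>, and is false if \<open>bad \<phi> \<psi>\<close>.
\<close>

inductive MS2IC_u :: "fm \<Rightarrow> bool" where
  taut: "tautology \<tau> \<Longrightarrow> MS2IC_u (subst \<sigma> \<tau>)"
| ax: "axiom \<phi> \<Longrightarrow> MS2IC_u \<phi>"
| MP: "MS2IC_u (\<phi> \<^bold>\<rightarrow> \<psi>) \<Longrightarrow> MS2IC_u \<phi> \<Longrightarrow> MS2IC_u \<psi>"
| R: "MS2IC_u \<phi> \<Longrightarrow> MS2IC_u (\<^bold>\<forall> \<phi>)"
| N: "MS2IC_u \<phi> \<Longrightarrow> MS2IC_u (\<^bold>\<box> \<phi>)"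
| RE: "MS2IC_u (\<phi> \<^bold>\<leftrightarrow> \<phi>') \<Longrightarrow> MS2IC_u (\<psi> \<^bold>\<leftrightarrow> \<psi>') \<Longrightarrow>
    MS2IC_u ((\<phi> \<leadsto> \<psi>) \<^bold>\<leftrightarrow> (\<phi>' \<leadsto> \<psi>'))"
| rho6: "MS2IC_u ((\<phi> \<leadsto> Var p) \<^bold>\<and> (Var p \<leadsto> \<psi>) \<^bold>\<rightarrow> \<chi>) \<Longrightarrow> p \<notin> vars \<phi> \<union> vars \<psi> \<union> vars \<chi> \<Longrightarrow>
    MS2IC_u ((\<phi> \<leadsto> \<psi>) \<^bold>\<rightarrow> \<chi>)"
| rho7: "MS2IC_u ((Var p \<leadsto> \<phi>) \<^bold>\<and> Var p \<^bold>\<rightarrow> \<chi>) \<Longrightarrow> p \<notin> vars \<phi> \<union> vars \<chi> \<Longrightarrow>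
    MS2IC_u (\<phi> \<^bold>\<rightarrow> \<chi>)"
| UC: "MS2IC_u ((Var p \<leadsto> \<phi>) \<^bold>\<and> \<^bold>\<box> (Var p) \<^bold>\<rightarrow> \<psi>) \<Longrightarrow> p \<notin> vars \<phi> \<union> vars \<psi> \<Longrightarrow>
    MS2IC_u (\<^bold>\<box> \<phi> \<^bold>\<rightarrow> \<psi>)"

primrec conj_list :: "fm list \<Rightarrow> fm" where
  "conj_list [] = \<^bold>\<top>"
| "conj_list (\<gamma> # \<gamma>s) = \<gamma> \<^bold>\<and> conj_list \<gamma>s"

definition derives :: "fm set \<Rightarrow> fm \<Rightarrow> bool"  (infix \<open>\<turnstile>\<^sub>u\<close> 40)
  where "\<Gamma> \<turnstile>\<^sub>u \<phi> \<longleftrightarrow> (\<exists>\<gamma>s. set \<gamma>s \<subseteq> \<Gamma> \<and> MS2IC_u (\<^bold>\<forall> (conj_list \<gamma>s) \<^bold>\<rightarrow> \<phi>))"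

section \<open>Algebras\<close>

locale boolean_lattice = bounded_lattice +
  assumes distrib: "\<lbrakk>x \<in> carrier L; y \<in> carrier L; z \<in> carrier L\<rbrakk> \<Longrightarrow>
      x \<sqinter> (y \<squnion> z) = (x \<sqinter> y) \<squnion> (x \<sqinter> z)"
    and complement_exists: "x \<in> carrier L \<Longrightarrow>
      \<exists>y\<in>carrier L. x \<sqinter> y = \<bottom> \<and> x \<squnion> y = \<top>"

definition compl :: "('a, 'm) gorder_scheme \<Rightarrow> 'a \<Rightarrow> 'a"  (\<open>\<sim>\<index> _\<close> [81] 80)
  where "\<sim>\<^bsub>L\<^esub> x = (THE y. y \<in> carrier L \<and> x \<sqinter>\<^bsub>L\<^esub> y = \<bottom>\<^bsub>L\<^esub> \<and> x \<squnion>\<^bsub>L\<^esub> y = \<top>\<^bsub>L\<^esub>)"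

record 'a modal_contact = "'a gorder" +
  prec :: "'a \<Rightarrow> 'a \<Rightarrow> bool"  (infix \<open>\<prec>\<index>\<close> 50)
  dia :: "'a \<Rightarrow> 'a"  (\<open>\<diamond>\<index> _\<close> [81] 80)

locale contact_algebra = boolean_lattice L
  for L :: "('a, 'm) modal_contact_scheme" (structure) +
  assumes prec_bottom: "\<bottom> \<prec> \<bottom>"
    and prec_top: "\<top> \<prec> \<top>"
    and prec_meet: "\<lbrakk>a \<in> carrier L; b \<in> carrier L; c \<in> carrier L; a \<prec> b; a \<prec> c\<rbrakk> \<Longrightarrow> a \<prec> b \<sqinter> c"
    and prec_join: "\<lbrakk>a \<in> carrier L; b \<in> carrier L; c \<in> carrier L; a \<prec> c; b \<prec> c\<rbrakk> \<Longrightarrow> a \<squnion> b \<prec> c"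
    and prec_mono: "\<lbrakk>a \<in> carrier L; b \<in> carrier L; c \<in> carrier L; d \<in> carrier L;
      a \<sqsubseteq> b; b \<prec> c; c \<sqsubseteq> d\<rbrakk> \<Longrightarrow> a \<prec> d"
    and prec_le: "\<lbrakk>a \<in> carrier L; b \<in> carrier L; a \<prec> b\<rbrakk> \<Longrightarrow> a \<sqsubseteq> b"
    and prec_compl: "\<lbrakk>a \<in> carrier L; b \<in> carrier L; a \<prec> b\<rbrakk> \<Longrightarrow> \<sim> b \<prec> \<sim> a"

locale compingent_algebra = contact_algebra +
  assumes prec_interpolate: "\<lbrakk>a \<in> carrier L; b \<in> carrier L; a \<prec> b\<rbrakk> \<Longrightarrow>
      \<exists>c\<in>carrier L. a \<prec> c \<and> c \<prec> b"
    and prec_nonzero: "\<lbrakk>a \<in> carrier L; a \<noteq> \<bottom>\<rbrakk> \<Longrightarrow> \<exists>b\<in>carrier L. b \<noteq> \<bottom> \<and> b \<prec> a"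

locale de_Vries_algebra = compingent_algebra + complete_lattice

locale modal_contact_algebra = contact_algebra +
  assumes dia_closed: "a \<in> carrier L \<Longrightarrow> \<diamond> a \<in> carrier L"
    and dia_bottom: "\<diamond> \<bottom> = \<bottom>"
    and dia_additive: "\<lbrakk>a\<^sub>1 \<in> carrier L; b\<^sub>1 \<in> carrier L; a\<^sub>2 \<in> carrier L; b\<^sub>2 \<in> carrier L;
      a\<^sub>1 \<prec> b\<^sub>1; a\<^sub>2 \<prec> b\<^sub>2\<rbrakk> \<Longrightarrow> \<diamond> (a\<^sub>1 \<squnion> a\<^sub>2) \<prec> \<diamond> b\<^sub>1 \<squnion> \<diamond> b\<^sub>2"

locale modal_de_Vries_algebra = modal_contact_algebra + de_Vries_algebra

locale upper_continuous_modal_de_Vries_algebra = modal_de_Vries_algebra +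
  assumes upper_continuous: "a \<in> carrier L \<Longrightarrow>
      is_glb L (\<diamond> a) {\<diamond> b | b. b \<in> carrier L \<and> a \<prec> b}"

definition UMDV :: "'a modal_contact set"
  where "UMDV = {L. upper_continuous_modal_de_Vries_algebra L}"

section \<open>Semantics\<close>

primrec val :: "'a modal_contact \<Rightarrow> (nat \<Rightarrow> 'a) \<Rightarrow> fm \<Rightarrow> 'a" where
  "val L v (Var p) = v p"
| "val L v \<^bold>\<top> = \<top>\<^bsub>L\<^esub>"
| "val L v \<^bold>\<bottom> = \<bottom>\<^bsub>L\<^esub>"
| "val L v (\<^bold>\<not> \<phi>) = \<sim>\<^bsub>L\<^esub> val L v \<phi>"
| "val L v (\<phi> \<^bold>\<and> \<psi>) = val L v \<phi> \<sqinter>\<^bsub>L\<^esub> val L v \<psi>"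
| "val L v (\<phi> \<^bold>\<or> \<psi>) = val L v \<phi> \<squnion>\<^bsub>L\<^esub> val L v \<psi>"
| "val L v (\<phi> \<^bold>\<rightarrow> \<psi>) = (\<sim>\<^bsub>L\<^esub> val L v \<phi>) \<squnion>\<^bsub>L\<^esub> val L v \<psi>"
| "val L v (\<phi> \<^bold>\<leftrightarrow> \<psi>) =
    ((\<sim>\<^bsub>L\<^esub> val L v \<phi>) \<squnion>\<^bsub>L\<^esub> val L v \<psi>) \<sqinter>\<^bsub>L\<^esub> ((\<sim>\<^bsub>L\<^esub> val L v \<psi>) \<squnion>\<^bsub>L\<^esub> val L v \<phi>)"
| "val L v (\<phi> \<leadsto> \<psi>) = (if val L v \<phi> \<prec>\<^bsub>L\<^esub> val L v \<psi> then \<top>\<^bsub>L\<^esub> else \<bottom>\<^bsub>L\<^esub>)"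
| "val L v (\<^bold>\<box> \<phi>) = \<sim>\<^bsub>L\<^esub> (\<diamond>\<^bsub>L\<^esub> (\<sim>\<^bsub>L\<^esub> val L v \<phi>))"

definition entails :: "'a modal_contact set \<Rightarrow> fm set \<Rightarrow> fm \<Rightarrow> bool"
  where "entails \<K> \<Gamma> \<phi> \<longleftrightarrow> (\<forall>L\<in>\<K>. \<forall>v. range v \<subseteq> carrier L \<longrightarrow>
    (\<forall>\<gamma>\<in>\<Gamma>. val L v \<gamma> = \<top>\<^bsub>L\<^esub>) \<longrightarrow> val L v \<phi> = \<top>\<^bsub>L\<^esub>)"

text \<open>
  A HOL term cannot quantify over all types, so \<open>UMDV\<close> is the class of algebras whose carrier is a
  subset of a given type. It is used at the types \<open>'u + fm set\<close>, with \<open>'u\<close> an arbitrary type: every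
  algebra whatsoever on a carrier in \<open>'u\<close> has a copy there, and \<open>fm set\<close> ensures that the type never
  has fewer than continuum many elements, so that countermodels exist also when \<open>'u\<close> is small.
\<close>

type_synonym 'u univ = "'u + fm set"

end

theory Submission
  imports Defs "HOL-Library.Countable"
begin

text \<open>
  Soundness reduces to two-valued reasoning: two elements of a Boolean lattice are equal iff no
  homomorphism onto the two-element algebra separates them. Upper continuity turns de Vries additivity
  of the diamond into additivity, which is what axiom K needs.

  For completeness, injectively rename the variables of \<open>\<Gamma>\<close> and \<open>\<phi>\<close> so that infinitely many stay
  unused, and build a Henkin theory \<open>T\<close> that decides all formulas \<open>\<psi> \<leadsto> \<chi>\<close>; the rules \<open>\<rho>6\<close>, \<open>\<rho>7\<close> and
  \<open>UC\<close> are exactly what makes adding the witnesses for interpolation, for non-zero elements and for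
  upper continuity consistent. The Lindenbaum algebra of \<open>T\<close> is then an upper continuous modal
  compingent algebra, and the countermodel is its MacNeille completion, whose elements are
  represented by the sets of formulas \<open>X\<close> with \<open>X\<^sup>\<bottom>\<^sup>\<bottom> = X\<close>.
\<close>

section \<open>Soundness\<close>

text \<open>A theory deciding every formula would have a Lindenbaum algebra with only two elements,
  so \<open>T\<close> must not be a maximal consistent set in the propositional sense. Consistency
  is measured by the global consequence \<open>\<turnstile>\<^sub>u\<close> instead, whose deduction
  theorem moves a premise \<open>\<alpha>\<close> to the right as \<open>Univ \<alpha>\<close>. A
  set that is maximal for this notion decides exactly as much as is needed: a formula that implies
  its own \<open>Univ\<close> is either a member or refuted. Every
  \<open>\<phi> \<leadsto> \<psi>\<close> is of this kind, which is why strict implication takes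
  only the values top and bottom, while other formulas may stay undecided.

  For the same reason each witness formula has to imply its own \<open>Univ\<close>; otherwise the
  rules with a fresh variable could not be applied to what the deduction theorem delivers.

  The properties of the Lindenbaum algebra survive completion because relation and diamond of the
  completion are defined through formulas: two cuts are related if some related pair of formulas
  lies between them, and the diamond of a cut is the meet of the diamonds of the formulas above
  it.\<close>

context boolean_lattice
begin

lemma top_meet_eq: "x \<in> carrier L \<Longrightarrow> \<top> \<sqinter> x = x"
  using top_meet unfolding eq_is_equal .

lemma bottom_join_eq: "x \<in> carrier L \<Longrightarrow> \<bottom> \<squnion> x = x"
  using bottom_join unfolding eq_is_equal .

lemma le_bottomD: "x \<sqsubseteq> \<bottom> \<Longrightarrow> x \<in> carrier L \<Longrightarrow> x = \<bottom>"
  using bottom_lower le_antisym bottom_closed by blast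

lemma le_of_disjoint_complement:
  assumes "x \<in> carrier L" "y \<in> carrier L" "z \<in> carrier L" "x \<sqinter> y = \<bottom>" "y \<squnion> z = \<top>"
  shows "x \<sqsubseteq> z"
proof -
  have "x = x \<sqinter> (y \<squnion> z)"
    using assms top_meet_eq[of x] by (simp add: meet_comm)
  also have "\<dots> = x \<sqinter> z"
    using assms distrib[of x y z] bottom_join_eq[of "x \<sqinter> z"] by simp
  finally show ?thesis
    using assms meet_right by metis
qed

lemma complement_unique:
  assumes "x \<in> carrier L" "y \<in> carrier L" "z \<in> carrier L"
    and "x \<sqinter> y = \<bottom>" "x \<squnion> y = \<top>" "x \<sqinter> z = \<bottom>" "x \<squnion> z = \<top>"
  shows "y = z"
  using assms le_of_disjoint_complement[of y x z] le_of_disjoint_complement[of z x y]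
  by (auto simp: meet_comm intro: le_antisym)

lemma compl_props:
  assumes "x \<in> carrier L"
  shows compl_closed: "\<sim> x \<in> carrier L"
    and meet_compl: "x \<sqinter> \<sim> x = \<bottom>"
    and join_compl: "x \<squnion> \<sim> x = \<top>"
proof -
  have "\<exists>!y. y \<in> carrier L \<and> x \<sqinter> y = \<bottom> \<and> x \<squnion> y = \<top>"
    using complement_exists[OF assms] complement_unique[OF assms] by blast
  from theI'[OF this] show "\<sim> x \<in> carrier L" "x \<sqinter> \<sim> x = \<bottom>" "x \<squnion> \<sim> x = \<top>"
    by (auto simp: compl_def)
qed

lemma compl_eqI:
  "\<lbrakk>x \<in> carrier L; y \<in> carrier L; x \<sqinter> y = \<bottom>; x \<squnion> y = \<top>\<rbrakk> \<Longrightarrow> \<sim> x = y"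
  using complement_unique[of x "\<sim> x" y] compl_props[of x] by blast

section \<open>Ultrafilters and homomorphisms onto the two-element algebra\<close>

definition bool_hom :: "('a \<Rightarrow> bool) \<Rightarrow> bool" where
  "bool_hom h \<longleftrightarrow> h \<top> \<and> \<not> h \<bottom> \<and>
    (\<forall>x\<in>carrier L. h (\<sim> x) \<longleftrightarrow> \<not> h x) \<and>
    (\<forall>x\<in>carrier L. \<forall>y\<in>carrier L. (h (x \<sqinter> y) \<longleftrightarrow> h x \<and> h y) \<and> (h (x \<squnion> y) \<longleftrightarrow> h x \<or> h y))"

definition proper_filter :: "'a set \<Rightarrow> bool" where
  "proper_filter F \<longleftrightarrow> F \<subseteq> carrier L \<and> \<bottom> \<notin> F \<and> F \<noteq> {} \<and> (\<forall>x\<in>F. \<forall>y\<in>F. x \<sqinter> y \<in> F) \<and>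
    (\<forall>x\<in>F. \<forall>y\<in>carrier L. x \<sqsubseteq> y \<longrightarrow> y \<in> F)"

lemma principal_proper_filter:
  assumes "a \<in> carrier L" "a \<noteq> \<bottom>"
  shows "proper_filter {x \<in> carrier L. a \<sqsubseteq> x}"
  unfolding proper_filter_def
  using assms le_bottomD by (auto intro: meet_le le_trans)

lemma Union_chain_proper_filter:
  assumes "\<C> \<noteq> {}" "\<And>F. F \<in> \<C> \<Longrightarrow> proper_filter F" "\<And>F G. F \<in> \<C> \<Longrightarrow> G \<in> \<C> \<Longrightarrow> F \<subseteq> G \<or> G \<subseteq> F"
  shows "proper_filter (\<Union>\<C>)"
proof -
  have "x \<sqinter> y \<in> \<Union>\<C>" if "x \<in> F" "F \<in> \<C>" "y \<in> G" "G \<in> \<C>" for x y F G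
    using that assms(3)[of F G] assms(2)[of F] assms(2)[of G] unfolding proper_filter_def by blast
  with assms(1,2) show ?thesis
    unfolding proper_filter_def by blast
qed

text \<open>Zorn's lemma gives a filter \<open>U\<close> that is maximal among the proper filters
  containing \<open>a\<close>. If \<open>x\<close> is missing from \<open>U\<close>, then adjoining
  \<open>x\<close> destroys properness, so some \<open>u\<close> in \<open>U\<close> is disjoint
  from \<open>x\<close> and hence lies below \<open>\<sim> x\<close>.\<close>

lemma ultrafilter_exists:
  assumes "a \<in> carrier L" "a \<noteq> \<bottom>"
  shows "\<exists>U. proper_filter U \<and> a \<in> U \<and> (\<forall>x\<in>carrier L. x \<notin> U \<longrightarrow> \<sim> x \<in> U)"
proof -
  let ?\<F> = "{F. proper_filter F \<and> a \<in> F}"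
  have "\<exists>U\<in>?\<F>. \<forall>F\<in>?\<F>. U \<subseteq> F \<longrightarrow> F = U"
  proof (rule subset_Zorn_nonempty)
    show "?\<F> \<noteq> {}"
      using principal_proper_filter[OF assms] assms by auto
    fix \<C> assume "\<C> \<noteq> {}" "subset.chain ?\<F> \<C>"
    then show "\<Union>\<C> \<in> ?\<F>"
      using Union_chain_proper_filter[of \<C>] unfolding subset.chain_def by blast
  qed
  then obtain U where U: "proper_filter U" "a \<in> U"
    and max: "\<And>F. proper_filter F \<Longrightarrow> U \<subseteq> F \<Longrightarrow> F = U"
    by blast
  have "\<sim> x \<in> U" if x: "x \<in> carrier L" "x \<notin> U" for x
  proof -
    \<comment> \<open>The filter generated by \<open>U\<close> and \<open>x\<close>. By maximality
      it is not proper; as it is closed under meets and upwards, it must contain bottom.\<close>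
    let ?G = "{y \<in> carrier L. \<exists>u\<in>U. u \<sqinter> x \<sqsubseteq> y}"
    have UL: "U \<subseteq> carrier L" using U unfolding proper_filter_def by blast
    have "U \<subseteq> ?G" using UL x meet_left by blast
    moreover have "x \<in> ?G" using UL x U(2) meet_right by blast
    ultimately have "\<not> proper_filter ?G" using max[of ?G] x by blast
    moreover have "y \<sqinter> z \<in> ?G" if "y \<in> ?G" "z \<in> ?G" for y z
    proof -
      from that obtain u w where uw: "u \<in> U" "w \<in> U" "u \<sqinter> x \<sqsubseteq> y" "w \<sqinter> x \<sqsubseteq> z" by blast
      have c: "u \<in> carrier L" "w \<in> carrier L" "y \<in> carrier L" "z \<in> carrier L"
        using uw UL that by auto
      have "u \<sqinter> w \<sqinter> x \<sqsubseteq> u \<sqinter> x" "u \<sqinter> w \<sqinter> x \<sqsubseteq> w \<sqinter> x"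
        using c x by (meson meet_closed meet_le meet_left meet_right le_trans)+
      then have "u \<sqinter> w \<sqinter> x \<sqsubseteq> y \<sqinter> z"
        using c x uw by (meson meet_closed meet_le le_trans)
      then show ?thesis using c uw U(1) unfolding proper_filter_def by auto
    qed
    moreover have "z \<in> ?G" if "y \<in> ?G" "z \<in> carrier L" "y \<sqsubseteq> z" for y z
      using that UL x by (blast intro: le_trans meet_closed)
    ultimately have "\<bottom> \<in> ?G"
      using \<open>x \<in> ?G\<close> unfolding proper_filter_def by blast
    then obtain u where u: "u \<in> U" "u \<sqinter> x \<sqsubseteq> \<bottom>" by blast
    then have "u \<sqsubseteq> \<sim> x"
      using UL x le_bottomD[of "u \<sqinter> x"] le_of_disjoint_complement[of u x "\<sim> x"]
        compl_props[of x] by auto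
    then show ?thesis
      using u U(1) x compl_closed unfolding proper_filter_def by blast
  qed
  with U show ?thesis by blast
qed

lemma bool_hom_exists:
  assumes "a \<in> carrier L" "a \<noteq> \<bottom>"
  shows "\<exists>h. bool_hom h \<and> h a"
proof -
  obtain U where U: "proper_filter U" and aU: "a \<in> U"
    and ultra: "\<And>x. x \<in> carrier L \<Longrightarrow> x \<notin> U \<Longrightarrow> \<sim> x \<in> U"
    using ultrafilter_exists[OF assms] by metis
  have bot: "\<bottom> \<notin> U"
    and meetU: "\<And>x y. x \<in> U \<Longrightarrow> y \<in> U \<Longrightarrow> x \<sqinter> y \<in> U"
    and upU: "\<And>x y. x \<in> U \<Longrightarrow> y \<in> carrier L \<Longrightarrow> x \<sqsubseteq> y \<Longrightarrow> y \<in> U"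
    using U unfolding proper_filter_def by simp_all
  have cU: "\<sim> x \<in> U \<longleftrightarrow> x \<notin> U" if "x \<in> carrier L" for x
    using ultra[OF that] meetU[of x "\<sim> x"] meet_compl[OF that] bot by auto
  have mU: "x \<sqinter> y \<in> U \<longleftrightarrow> x \<in> U \<and> y \<in> U" if "x \<in> carrier L" "y \<in> carrier L" for x y
    using that meetU[of x y] upU[of "x \<sqinter> y"] meet_left[of x y] meet_right[of x y] by metis
  have jU: "x \<squnion> y \<in> U \<longleftrightarrow> x \<in> U \<or> y \<in> U" if c: "x \<in> carrier L" "y \<in> carrier L" for x y
  proof
    assume j: "x \<squnion> y \<in> U"
    show "x \<in> U \<or> y \<in> U"
    proof (rule ccontr)
      assume "\<not> (x \<in> U \<or> y \<in> U)"
      then have "\<sim> x \<sqinter> (x \<squnion> y) \<in> U" "y \<notin> U" using cU c j meetU by auto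
      moreover have "\<sim> x \<sqinter> (x \<squnion> y) = \<sim> x \<sqinter> y"
        using c compl_props[of x] distrib[of "\<sim> x" x y] bottom_join_eq[of "\<sim> x \<sqinter> y"]
        by (simp add: meet_comm)
      ultimately show False using mU[of "\<sim> x" y] c compl_closed by simp
    qed
  next
    assume "x \<in> U \<or> y \<in> U"
    then show "x \<squnion> y \<in> U"
      using c upU[of x "x \<squnion> y"] upU[of y "x \<squnion> y"] join_left[of x y] join_right[of x y] by auto
  qed
  have "\<top> \<in> U" using upU[OF aU top_closed] assms top_higher by simp
  then have "bool_hom (\<lambda>x. x \<in> U)"
    unfolding bool_hom_def using bot cU mU jU by blast
  with aU show ?thesis by blast
qed

text \<open>If \<open>x \<sqinter> \<sim> y\<close> were non-zero, a homomorphism true at it would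
  be true at \<open>x\<close> and false at \<open>y\<close>. From here on, Boolean identities and
  inequalities are left to propositional reasoning about the values of \<open>h\<close>.\<close>

lemma le_bool_homI:
  assumes "x \<in> carrier L" "y \<in> carrier L" "\<And>h. bool_hom h \<Longrightarrow> h x \<Longrightarrow> h y"
  shows "x \<sqsubseteq> y"
proof (cases "x \<sqinter> \<sim> y = \<bottom>")
  case True
  then show ?thesis
    using assms compl_props[of y]
      by (intro le_of_disjoint_complement[of x "\<sim> y" y]) (auto simp: join_comm)
next
  case False
  then obtain h where "bool_hom h" "h (x \<sqinter> \<sim> y)"
    using bool_hom_exists[of "x \<sqinter> \<sim> y"] assms compl_closed by auto
  then have "h x" "\<not> h y" using assms compl_closed unfolding bool_hom_def by auto
  then show ?thesis using \<open>bool_hom h\<close> assms(3) by blast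
qed

lemma bool_hom_mono: "\<lbrakk>bool_hom h; x \<in> carrier L; y \<in> carrier L; x \<sqsubseteq> y; h x\<rbrakk> \<Longrightarrow> h y"
  using le_iff_meet[of x y] unfolding bool_hom_def by metis

lemma le_iff_bool_hom:
  assumes "x \<in> carrier L" "y \<in> carrier L"
  shows "x \<sqsubseteq> y \<longleftrightarrow> (\<forall>h. bool_hom h \<longrightarrow> h x \<longrightarrow> h y)"
  using assms le_bool_homI bool_hom_mono by blast

lemma eq_iff_bool_hom:
  assumes "x \<in> carrier L" "y \<in> carrier L"
  shows "x = y \<longleftrightarrow> (\<forall>h. bool_hom h \<longrightarrow> h x = h y)"
  using assms le_iff_bool_hom[of x y] le_iff_bool_hom[of y x] le_antisym by blast

lemma eq_top_iff_bool_hom: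
  assumes "x \<in> carrier L"
  shows "x = \<top> \<longleftrightarrow> (\<forall>h. bool_hom h \<longrightarrow> h x)"
  using assms eq_iff_bool_hom[of x \<top>] unfolding bool_hom_def by auto

lemma bool_hom_simps:
  assumes "bool_hom h"
  shows "h \<top>" "\<not> h \<bottom>" "x \<in> carrier L \<Longrightarrow> h (\<sim> x) \<longleftrightarrow> \<not> h x"
    "x \<in> carrier L \<Longrightarrow> y \<in> carrier L \<Longrightarrow> h (x \<sqinter> y) \<longleftrightarrow> h x \<and> h y"
    "x \<in> carrier L \<Longrightarrow> y \<in> carrier L \<Longrightarrow> h (x \<squnion> y) \<longleftrightarrow> h x \<or> h y"
  using assms unfolding bool_hom_def by auto

lemma compl_compl: "x \<in> carrier L \<Longrightarrow> \<sim> (\<sim> x) = x"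
  by (simp add: eq_iff_bool_hom compl_closed bool_hom_simps)

lemma compl_antimono: "\<lbrakk>x \<in> carrier L; y \<in> carrier L; x \<sqsubseteq> y\<rbrakk> \<Longrightarrow> \<sim> y \<sqsubseteq> \<sim> x"
  by (auto simp add: le_iff_bool_hom compl_closed bool_hom_simps)

lemma compl_top: "\<sim> \<top> = \<bottom>" and compl_bottom: "\<sim> \<bottom> = \<top>"
  by (simp_all add: eq_iff_bool_hom compl_closed bool_hom_simps)

end

section \<open>Contact and compingent algebras\<close>

context contact_algebra
begin

lemma prec_le_le:
  "\<lbrakk>b \<prec> c; a \<sqsubseteq> b; c \<sqsubseteq> d; a \<in> carrier L; b \<in> carrier L; c \<in> carrier L; d \<in> carrier L\<rbrakk> \<Longrightarrow> a \<prec> d"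
  using prec_mono by blast

lemma prec_join_iff:
  "\<lbrakk>a \<in> carrier L; b \<in> carrier L; c \<in> carrier L\<rbrakk> \<Longrightarrow> a \<squnion> b \<prec> c \<longleftrightarrow> a \<prec> c \<and> b \<prec> c"
  by (auto intro: prec_join intro: prec_le_le[of "a \<squnion> b" c] join_left join_right)

lemma prec_meet_iff:
  "\<lbrakk>a \<in> carrier L; b \<in> carrier L; c \<in> carrier L\<rbrakk> \<Longrightarrow> a \<prec> b \<sqinter> c \<longleftrightarrow> a \<prec> b \<and> a \<prec> c"
  by (auto intro: prec_meet intro: prec_le_le[of a "b \<sqinter> c"] meet_left meet_right)

lemma prec_compl_iff:
  "\<lbrakk>a \<in> carrier L; b \<in> carrier L\<rbrakk> \<Longrightarrow> \<sim> b \<prec> \<sim> a \<longleftrightarrow> a \<prec> b"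
  using prec_compl[of a b] prec_compl[of "\<sim> b" "\<sim> a"] by (auto simp: compl_closed compl_compl)

lemma bottom_prec: "a \<in> carrier L \<Longrightarrow> \<bottom> \<prec> a"
  by (rule prec_le_le[OF prec_bottom]) auto

lemma prec_top_right: "a \<in> carrier L \<Longrightarrow> a \<prec> \<top>"
  by (rule prec_le_le[OF prec_top]) auto

text \<open>The one-element algebra is a contact algebra in which top does precede bottom. The
  existence of \<open>h\<close> excludes it, which is why nested strict implications are evaluated
  under a given homomorphism.\<close>

lemma bool_hom_not_top_prec_bottom: "bool_hom h \<Longrightarrow> \<not> \<top> \<prec> \<bottom>"
  using prec_le[of \<top> \<bottom>] bool_hom_mono[of h \<top> \<bottom>] bool_hom_simps(1,2)[of h] by auto

end

context compingent_algebra
begin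

text \<open>This is the semantic content of the rule \<open>rho7\<close>: every element is the join
  of those that precede it. Otherwise a non-zero \<open>b\<close> precedes
  \<open>a \<sqinter> \<sim> c\<close>, and it would lie below both \<open>c\<close> and
  \<open>\<sim> c\<close>.\<close>

lemma le_of_prec_below:
  assumes "a \<in> carrier L" "c \<in> carrier L" "\<And>b. b \<in> carrier L \<Longrightarrow> b \<prec> a \<Longrightarrow> b \<sqsubseteq> c"
  shows "a \<sqsubseteq> c"
proof (rule ccontr)
  note [simp] = compl_closed assms(1,2)
  assume "\<not> a \<sqsubseteq> c"
  then have "a \<sqinter> \<sim> c \<noteq> \<bottom>"
    by (auto simp: le_iff_bool_hom eq_iff_bool_hom bool_hom_simps)
  then obtain b where b: "b \<in> carrier L" "b \<noteq> \<bottom>" "b \<prec> a \<sqinter> \<sim> c"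
    using prec_nonzero[of "a \<sqinter> \<sim> c"] by auto
  then have "b \<prec> a" by (intro prec_mono[of b b "a \<sqinter> \<sim> c" a]) (auto intro: meet_left)
  then have "b \<sqsubseteq> c" using assms b by blast
  moreover have "b \<sqsubseteq> a \<sqinter> \<sim> c" using b by (auto intro: prec_le)
  ultimately have "b = \<bottom>"
    using b(1) by (auto simp: le_iff_bool_hom eq_iff_bool_hom bool_hom_simps)
  with b show False by blast
qed

end

section \<open>Additivity of an upper continuous diamond\<close>

context upper_continuous_modal_de_Vries_algebra
begin

lemma dia_greatest:
  assumes "a \<in> carrier L" "x \<in> carrier L" "\<And>b. b \<in> carrier L \<Longrightarrow> a \<prec> b \<Longrightarrow> x \<sqsubseteq> \<diamond> b"
  shows "x \<sqsubseteq> \<diamond> a"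
  using assms by (intro greatest_le[OF upper_continuous[OF assms(1)]] Lower_memI) auto

lemma dia_prec: "\<lbrakk>a \<in> carrier L; b \<in> carrier L; a \<prec> b\<rbrakk> \<Longrightarrow> \<diamond> a \<prec> \<diamond> b"
  using dia_additive[of a b a b] dia_closed[of b]
  \<comment> \<open>Both summands are the same pair, and \<open>join_def\<close> turns each join
    into the supremum of a set that collapses to a singleton.\<close>
  by (simp add: join_def)

text \<open>De Vries additivity speaks only of related elements. Everything that \<open>b\<close>
  precedes is also preceded by \<open>a\<close>, so \<open>\<diamond> a\<close> is a lower bound of
  the set whose meet is \<open>\<diamond> b\<close>.\<close>

lemma dia_mono:
  assumes "a \<in> carrier L" "b \<in> carrier L" "a \<sqsubseteq> b"
  shows "\<diamond> a \<sqsubseteq> \<diamond> b"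
proof (rule dia_greatest)
  fix c assume c: "c \<in> carrier L" "b \<prec> c"
  then have "a \<prec> c" using prec_mono[of a b c c] assms by simp
  then show "\<diamond> a \<sqsubseteq> \<diamond> c"
    using c assms dia_prec[of a c] prec_le[of "\<diamond> a" "\<diamond> c"] dia_closed by simp
qed (use assms dia_closed in auto)

text \<open>Additivity bounds \<open>\<diamond> (a \<squnion> b)\<close> by
  \<open>\<diamond> c \<squnion> \<diamond> d\<close> whenever \<open>a \<prec> c\<close> and
  \<open>b \<prec> d\<close>. The meet is taken over \<open>c\<close> first and over
  \<open>d\<close> afterwards; each time the other summand is carried to the left as a complement,
  so that no infinite distributive law is involved.\<close>

lemma dia_join_le:
  assumes "a \<in> carrier L" "b \<in> carrier L"
  shows "\<diamond> (a \<squnion> b) \<sqsubseteq> \<diamond> a \<squnion> \<diamond> b"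
proof -
  let ?e = "\<diamond> (a \<squnion> b)"
  note [simp] = dia_closed compl_closed assms
  have le: "?e \<sqsubseteq> \<diamond> c \<squnion> \<diamond> d" if "c \<in> carrier L" "d \<in> carrier L" "a \<prec> c" "b \<prec> d" for c d
    using that by (intro prec_le dia_additive) auto
  have 1: "?e \<sqinter> \<sim> (\<diamond> d) \<sqsubseteq> \<diamond> a" if d: "d \<in> carrier L" "b \<prec> d" for d
  proof (rule dia_greatest)
    fix c assume "c \<in> carrier L" "a \<prec> c"
    then show "?e \<sqinter> \<sim> (\<diamond> d) \<sqsubseteq> \<diamond> c"
      using le[of c d] d by (auto simp: le_iff_bool_hom bool_hom_simps)
  qed (use d in auto)
  have "?e \<sqinter> \<sim> (\<diamond> a) \<sqsubseteq> \<diamond> b"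
  proof (rule dia_greatest)
    fix d assume "d \<in> carrier L" "b \<prec> d"
    then show "?e \<sqinter> \<sim> (\<diamond> a) \<sqsubseteq> \<diamond> d"
      using 1[of d] by (auto simp: le_iff_bool_hom bool_hom_simps)
  qed auto
  then show ?thesis by (auto simp: le_iff_bool_hom bool_hom_simps)
qed

text \<open>Upper continuity at \<open>\<sim> a\<close>, dualised: the box of \<open>a\<close> is
  the join of the boxes of the elements preceding \<open>a\<close>. This is the semantic content of
  the rule \<open>UC\<close>.\<close>

lemma compl_dia_compl_le_of_prec_below:
  assumes "a \<in> carrier L" "c \<in> carrier L"
    and "\<And>b. b \<in> carrier L \<Longrightarrow> b \<prec> a \<Longrightarrow> \<sim> (\<diamond> (\<sim> b)) \<sqsubseteq> c"
  shows "\<sim> (\<diamond> (\<sim> a)) \<sqsubseteq> c"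
proof -
  note [simp] = compl_closed dia_closed assms(1,2)
  have "\<sim> c \<sqsubseteq> \<diamond> (\<sim> a)"
  proof (rule dia_greatest)
    fix b assume b: "b \<in> carrier L" "\<sim> a \<prec> b"
    then have "\<sim> b \<prec> a" using prec_compl[of "\<sim> a" b] by (simp add: compl_compl)
    then have "\<sim> (\<diamond> b) \<sqsubseteq> c" using assms(3)[of "\<sim> b"] b by (simp add: compl_compl)
    then show "\<sim> c \<sqsubseteq> \<diamond> b" using b compl_antimono[of "\<sim> (\<diamond> b)" c] by (simp add: compl_compl)
  qed auto
  then show ?thesis using compl_antimono[of "\<sim> c" "\<diamond> (\<sim> a)"] by (simp add: compl_compl)
qed

end

section \<open>Soundness of the axioms and rules\<close>

lemma val_cong_vars: "(\<And>p. p \<in> vars \<phi> \<Longrightarrow> v p = w p) \<Longrightarrow> val L v \<phi> = val L w \<phi>"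
  by (induction \<phi>) auto

lemma val_upd:
  "p \<notin> vars \<phi> \<Longrightarrow> val L (v(p := c)) \<phi> = val L v \<phi>"
  by (rule val_cong_vars) auto

text \<open>The valuation \<open>val\<close> is only typed for records without further fields.\<close>

locale UMDV_algebra = upper_continuous_modal_de_Vries_algebra L
  for L :: "'a modal_contact" (structure)
begin

lemma val_closed [simp]: "range v \<subseteq> carrier L \<Longrightarrow> val L v \<phi> \<in> carrier L"
  by (induction \<phi>) (auto simp: compl_closed dia_closed)

lemma hom_val:
  assumes "bool_hom h" "range v \<subseteq> carrier L"
  shows "h (val L v \<^bold>\<top>)" "\<not> h (val L v \<^bold>\<bottom>)"
    "h (val L v (\<^bold>\<not> \<phi>)) \<longleftrightarrow> \<not> h (val L v \<phi>)"
    "h (val L v (\<phi> \<^bold>\<and> \<psi>)) \<longleftrightarrow> h (val L v \<phi>) \<and> h (val L v \<psi>)"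
    "h (val L v (\<phi> \<^bold>\<or> \<psi>)) \<longleftrightarrow> h (val L v \<phi>) \<or> h (val L v \<psi>)"
    "h (val L v (\<phi> \<^bold>\<rightarrow> \<psi>)) \<longleftrightarrow> (h (val L v \<phi>) \<longrightarrow> h (val L v \<psi>))"
    "h (val L v (\<phi> \<^bold>\<leftrightarrow> \<psi>)) \<longleftrightarrow> (h (val L v \<phi>) \<longleftrightarrow> h (val L v \<psi>))"
    "h (val L v (\<phi> \<leadsto> \<psi>)) \<longleftrightarrow> val L v \<phi> \<prec> val L v \<psi>"
    "h (val L v (\<^bold>\<box> \<phi>)) \<longleftrightarrow> \<not> h (\<diamond> (\<sim> val L v \<phi>))"
  using assms by (auto simp: bool_hom_simps compl_closed dia_closed)

lemma val_top_iff:
  assumes "range v \<subseteq> carrier L"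
  shows "val L v \<phi> = \<top> \<longleftrightarrow> (\<forall>h. bool_hom h \<longrightarrow> h (val L v \<phi>))"
  using assms by (simp add: eq_top_iff_bool_hom)

lemma val_subst_classical:
  assumes "bool_hom h" "range v \<subseteq> carrier L" "classical \<tau>"
  shows "h (val L v (subst \<sigma> \<tau>)) = truth (\<lambda>p. h (val L v (\<sigma> p))) \<tau>"
  using assms(3) by (induction \<tau>) (simp_all add: hom_val[OF assms(1,2)] del: val.simps)

lemma axiom_valid:
  assumes v: "range v \<subseteq> carrier L" and "axiom \<phi>"
  shows "val L v \<phi> = \<top>"
  using assms(2)
proof cases
  case (K \<phi> \<psi>)
  let ?x = "val L v \<phi>" and ?y = "val L v \<psi>"
  note [simp] = compl_closed dia_closed v
  \<comment> \<open>Axiom K read through the diamond: \<open>\<sim> y\<close> lies below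
    \<open>(x \<sqinter> \<sim> y) \<squnion> \<sim> x\<close>, and the diamond is monotone and
    additive.\<close>
  have "\<diamond> (\<sim> ?y) \<sqsubseteq> \<diamond> (\<sim> (\<sim> ?x \<squnion> ?y) \<squnion> \<sim> ?x)"
    by (rule dia_mono) (auto simp: le_iff_bool_hom bool_hom_simps)
  also have "\<dots> \<sqsubseteq> \<diamond> (\<sim> (\<sim> ?x \<squnion> ?y)) \<squnion> \<diamond> (\<sim> ?x)"
    by (rule dia_join_le) auto
  finally show ?thesis
    unfolding K by (auto simp: eq_top_iff_bool_hom le_iff_bool_hom bool_hom_simps)
next
  case (Add \<phi> \<psi>)
  then show ?thesis
    using v by (auto simp: eq_top_iff_bool_hom bool_hom_simps compl_closed dia_closed
        prec_compl_iff intro!: dia_prec)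
next
  case (A4 \<phi> \<psi>)
  then show ?thesis
    using v prec_le[of "val L v \<phi>" "val L v \<psi>"]
    by (auto simp: eq_top_iff_bool_hom bool_hom_simps compl_closed le_iff_bool_hom)
qed (use v in \<open>auto simp: eq_top_iff_bool_hom bool_hom_simps compl_closed prec_join_iff prec_meet_iff
  prec_compl_iff bottom_prec prec_top_right compl_top compl_bottom bool_hom_not_top_prec_bottom\<close>)

lemma val_imp_top_iff:
  "range v \<subseteq> carrier L \<Longrightarrow> val L v (\<phi> \<^bold>\<rightarrow> \<psi>) = \<top> \<longleftrightarrow> val L v \<phi> \<sqsubseteq> val L v \<psi>"
  by (simp add: val_top_iff hom_val le_iff_bool_hom del: val.simps)

lemma range_upd: "range v \<subseteq> carrier L \<Longrightarrow> c \<in> carrier L \<Longrightarrow> range (v(p := c)) \<subseteq> carrier L"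
  by auto

lemma MS2IC_u_sound: "MS2IC_u \<phi> \<Longrightarrow> range v \<subseteq> carrier L \<Longrightarrow> val L v \<phi> = \<top>"
\<comment> \<open>For \<open>rho6\<close>, \<open>rho7\<close> and \<open>UC\<close> the induction
  hypothesis is used at a valuation that sends the fresh \<open>p\<close> to a suitable element;
  freshness keeps the other values unchanged.\<close>
proof (induction arbitrary: v rule: MS2IC_u.induct)
  case (taut \<tau> \<sigma>)
  then show ?case by (simp add: val_top_iff val_subst_classical tautology_def)
next
  case (ax \<phi>)
  then show ?case using axiom_valid by blast
next
  case (MP \<phi> \<psi>)
  from MP.IH[OF MP.prems] show ?case
    using MP.prems by (auto simp add: val_top_iff hom_val bool_hom_simps simp del: val.simps)
next
  case (R \<phi>)
  then show ?case using prec_top by simp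
next
  case (N \<phi>)
  then show ?case by (simp add: compl_top compl_bottom dia_bottom)
next
  case (RE \<phi> \<phi>' \<psi> \<psi>')
  from RE.IH[OF RE.prems] have "val L v \<phi> = val L v \<phi>'" "val L v \<psi> = val L v \<psi>'"
    using RE.prems
    by (auto simp add: val_top_iff hom_val eq_iff_bool_hom bool_hom_simps simp del: val.simps)
  then show ?case
    using RE.prems by (simp add: val_top_iff hom_val del: val.simps)
next
  case (rho6 \<phi> p \<psi> \<chi>)
  have "val L v \<chi> = \<top>" if "val L v \<phi> \<prec> val L v \<psi>"
  proof -
    from that obtain c where c: "c \<in> carrier L" "val L v \<phi> \<prec> c" "c \<prec> val L v \<psi>"
      using prec_interpolate rho6.prems val_closed by meson
    from rho6.IH[OF range_upd[OF rho6.prems c(1), of p]] rho6.hyps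
    \<comment> \<open>The left side is the value of the premise's antecedent: with \<open>p\<close>
      sent to the interpolant \<open>c\<close>, both strict implications have value top.\<close>
    have "\<top> \<sqinter> \<top> \<sqsubseteq> val L v \<chi>"
      using c rho6.prems by (subst (asm) val_imp_top_iff) (auto simp: val_upd)
    then show ?thesis
      using rho6.prems by (simp add: le_iff_bool_hom eq_top_iff_bool_hom bool_hom_simps)
  qed
  then show ?case
    using rho6.prems by (auto simp add: val_imp_top_iff simp del: val.simps(7))
next
  case (rho7 p \<phi> \<chi>)
  have "val L v \<phi> \<sqsubseteq> val L v \<chi>"
  proof (rule le_of_prec_below)
    fix b assume b: "b \<in> carrier L" "b \<prec> val L v \<phi>"
    from rho7.IH[OF range_upd[OF rho7.prems b(1), of p]] rho7.hyps
    have "\<top> \<sqinter> b \<sqsubseteq> val L v \<chi>"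
      using b rho7.prems by (subst (asm) val_imp_top_iff) (auto simp: val_upd)
    then show "b \<sqsubseteq> val L v \<chi>" using b by (simp add: top_meet_eq)
  qed (use rho7.prems in auto)
  then show ?case using rho7.prems by (simp add: val_imp_top_iff del: val.simps)
next
  case (UC p \<phi> \<psi>)
  have "\<sim> (\<diamond> (\<sim> val L v \<phi>)) \<sqsubseteq> val L v \<psi>"
  proof (rule compl_dia_compl_le_of_prec_below)
    fix b assume b: "b \<in> carrier L" "b \<prec> val L v \<phi>"
    from UC.IH[OF range_upd[OF UC.prems b(1), of p]] UC.hyps
    have "\<top> \<sqinter> \<sim> (\<diamond> (\<sim> b)) \<sqsubseteq> val L v \<psi>"
      using b UC.prems by (subst (asm) val_imp_top_iff) (auto simp: val_upd)
    then show "\<sim> (\<diamond> (\<sim> b)) \<sqsubseteq> val L v \<psi>"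
      using b by (simp add: top_meet_eq compl_closed dia_closed)
  qed (use UC.prems in auto)
  then show ?case using UC.prems by (subst val_imp_top_iff) auto
qed

lemma val_conj_list_top:
  "\<lbrakk>range v \<subseteq> carrier L; \<forall>\<gamma>\<in>set \<gamma>s. val L v \<gamma> = \<top>\<rbrakk> \<Longrightarrow> val L v (conj_list \<gamma>s) = \<top>"
  by (induction \<gamma>s) (simp_all add: top_meet_eq)

lemma derives_sound:
  assumes "\<Gamma> \<turnstile>\<^sub>u \<phi>" "range v \<subseteq> carrier L" "\<forall>\<gamma>\<in>\<Gamma>. val L v \<gamma> = \<top>"
  shows "val L v \<phi> = \<top>"
proof -
  obtain \<gamma>s where \<gamma>s: "set \<gamma>s \<subseteq> \<Gamma>" "MS2IC_u (\<^bold>\<forall> (conj_list \<gamma>s) \<^bold>\<rightarrow> \<phi>)"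
    using assms(1) unfolding derives_def by blast
  have "val L v (conj_list \<gamma>s) = \<top>"
    using val_conj_list_top[OF assms(2), of \<gamma>s] assms(3) \<gamma>s(1) by blast
  then have "val L v (\<^bold>\<forall> (conj_list \<gamma>s)) = \<top>" using prec_top by simp
  then show ?thesis
    using MS2IC_u_sound[OF \<gamma>s(2) assms(2)] assms(2)
    by (auto simp add: val_top_iff hom_val simp del: val.simps)
qed

end

lemma derives_imp_entails: "\<Gamma> \<turnstile>\<^sub>u \<phi> \<Longrightarrow> entails UMDV \<Gamma> \<phi>"
  unfolding entails_def UMDV_def using UMDV_algebra.derives_sound UMDV_algebra.intro by blast

section \<open>Saturated theories\<close>

instance fm :: countable by countable_datatype

text \<open>Turns a formula into a classical one by replacing each outermost strict implication or
  box by a variable that codes it; \<open>subst from_nat\<close> undoes this. Variables are recoded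
  as well, so that they cannot clash with the codes of modal subformulas.\<close>

primrec skeleton :: "fm \<Rightarrow> fm" where
  "skeleton (Var p) = Var (to_nat (Var p))"
| "skeleton \<^bold>\<top> = \<^bold>\<top>"
| "skeleton \<^bold>\<bottom> = \<^bold>\<bottom>"
| "skeleton (\<^bold>\<not> \<phi>) = \<^bold>\<not> skeleton \<phi>"
| "skeleton (\<phi> \<^bold>\<and> \<psi>) = skeleton \<phi> \<^bold>\<and> skeleton \<psi>"
| "skeleton (\<phi> \<^bold>\<or> \<psi>) = skeleton \<phi> \<^bold>\<or> skeleton \<psi>"
| "skeleton (\<phi> \<^bold>\<rightarrow> \<psi>) = (skeleton \<phi> \<^bold>\<rightarrow> skeleton \<psi>)"
| "skeleton (\<phi> \<^bold>\<leftrightarrow> \<psi>) = (skeleton \<phi> \<^bold>\<leftrightarrow> skeleton \<psi>)"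
| "skeleton (\<phi> \<leadsto> \<psi>) = Var (to_nat (\<phi> \<leadsto> \<psi>))"
| "skeleton (\<^bold>\<box> \<phi>) = Var (to_nat (\<^bold>\<box> \<phi>))"

text \<open>Truth tables with variables, strict implications and boxes all as atoms: what
  \<open>truth\<close> computes on the skeleton, freed from the coding by numbers.\<close>

primrec pval :: "(fm \<Rightarrow> bool) \<Rightarrow> fm \<Rightarrow> bool" where
  "pval g (Var p) = g (Var p)"
| "pval g \<^bold>\<top> = True"
| "pval g \<^bold>\<bottom> = False"
| "pval g (\<^bold>\<not> \<phi>) = (\<not> pval g \<phi>)"
| "pval g (\<phi> \<^bold>\<and> \<psi>) = (pval g \<phi> \<and> pval g \<psi>)"
| "pval g (\<phi> \<^bold>\<or> \<psi>) = (pval g \<phi> \<or> pval g \<psi>)"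
| "pval g (\<phi> \<^bold>\<rightarrow> \<psi>) = (pval g \<phi> \<longrightarrow> pval g \<psi>)"
| "pval g (\<phi> \<^bold>\<leftrightarrow> \<psi>) = (pval g \<phi> \<longleftrightarrow> pval g \<psi>)"
| "pval g (\<phi> \<leadsto> \<psi>) = g (\<phi> \<leadsto> \<psi>)"
| "pval g (\<^bold>\<box> \<phi>) = g (\<^bold>\<box> \<phi>)"

lemma classical_skeleton: "classical (skeleton \<phi>)"
  by (induction \<phi>) auto

lemma subst_skeleton: "subst from_nat (skeleton \<phi>) = \<phi>"
  by (induction \<phi>) auto

lemma truth_skeleton: "truth e (skeleton \<phi>) = pval (\<lambda>\<alpha>. e (to_nat \<alpha>)) \<phi>"
  by (induction \<phi>) auto

lemma MS2IC_u_prop_valid: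
  assumes "\<And>g. pval g \<phi>"
  shows "MS2IC_u \<phi>"
proof -
  have "tautology (skeleton \<phi>)"
    using assms by (simp add: tautology_def classical_skeleton truth_skeleton)
  from taut[OF this, of from_nat] show ?thesis by (simp add: subst_skeleton)
qed

text \<open>The premises are discharged one by one as implications, down to a propositionally valid
  formula. \<open>T\<close> is left abstract because the lemma serves three sets: the theorems, the
  formulas derivable from \<open>S\<close>, and a saturated theory.\<close>

lemma prop_consequence_closed:
  assumes "\<And>\<phi>. MS2IC_u \<phi> \<Longrightarrow> \<phi> \<in> T" "\<And>\<phi> \<psi>. (\<phi> \<^bold>\<rightarrow> \<psi>) \<in> T \<Longrightarrow> \<phi> \<in> T \<Longrightarrow> \<psi> \<in> T"
    and "set \<alpha>s \<subseteq> T" "\<And>g. \<forall>\<alpha>\<in>set \<alpha>s. pval g \<alpha> \<Longrightarrow> pval g \<beta>"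
  shows "\<beta> \<in> T"
  using assms(3,4)
proof (induction \<alpha>s arbitrary: \<beta>)
  case Nil
  then show ?case using assms(1) MS2IC_u_prop_valid by simp
next
  case (Cons \<alpha> \<alpha>s)
  have "(\<alpha> \<^bold>\<rightarrow> \<beta>) \<in> T" using Cons.prems by (intro Cons.IH) auto
  then show ?case using assms(2) Cons.prems(1) by auto
qed

lemma MS2IC_u_consequence:
  assumes "\<forall>\<alpha>\<in>set \<alpha>s. MS2IC_u \<alpha>" "\<And>g. \<forall>\<alpha>\<in>set \<alpha>s. pval g \<alpha> \<Longrightarrow> pval g \<beta>"
  shows "MS2IC_u \<beta>"
  using prop_consequence_closed[of "Collect MS2IC_u" \<alpha>s \<beta>] assms MP by auto

section \<open>Closure of the calculus under substitution\<close>

lemma vars_finite: "finite (vars \<phi>)"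
  by (induction \<phi>) auto

lemma subst_cong: "(\<And>p. p \<in> vars \<phi> \<Longrightarrow> \<sigma> p = \<tau> p) \<Longrightarrow> subst \<sigma> \<phi> = subst \<tau> \<phi>"
  by (induction \<phi>) auto

lemma subst_upd: "p \<notin> vars \<phi> \<Longrightarrow> subst (\<sigma>(p := \<alpha>)) \<phi> = subst \<sigma> \<phi>"
  by (rule subst_cong) auto

lemma subst_subst: "subst \<sigma> (subst \<tau> \<phi>) = subst (\<lambda>p. subst \<sigma> (\<tau> p)) \<phi>"
  by (induction \<phi>) auto

lemma subst_Var: "subst Var \<phi> = \<phi>"
  by (induction \<phi>) auto

lemma axiom_subst: "axiom \<phi> \<Longrightarrow> axiom (subst \<sigma> \<phi>)"
  by (induction rule: axiom.induct) (auto intro: axiom.intros)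

lemma fresh_var: "\<exists>q. q \<notin> vars \<phi> \<union> vars \<psi> \<union> vars \<chi>"
  using ex_new_if_finite[of "vars \<phi> \<union> vars \<psi> \<union> vars \<chi>"] vars_finite infinite_UNIV_nat by blast

text \<open>The images under \<open>\<sigma>\<close> may contain the variable \<open>p\<close> that
  a rule requires to be fresh. The induction therefore runs over all \<open>\<sigma>\<close>, and in
  these cases \<open>p\<close> is redirected to a variable \<open>q\<close> not occurring in the
  substituted formulas.\<close>

lemma MS2IC_u_subst: "MS2IC_u \<phi> \<Longrightarrow> MS2IC_u (subst \<sigma> \<phi>)"
proof (induction arbitrary: \<sigma> rule: MS2IC_u.induct)
  case (taut \<tau> \<sigma>')
  then show ?case by (simp add: subst_subst MS2IC_u.taut)
next
  case (ax \<phi>)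
  then show ?case by (simp add: axiom_subst MS2IC_u.ax)
next
  case (MP \<phi> \<psi>)
  then show ?case by (metis subst.simps(7) MS2IC_u.MP)
next
  case (rho6 \<phi> p \<psi> \<chi>)
  obtain q where "q \<notin> vars (subst \<sigma> \<phi>) \<union> vars (subst \<sigma> \<psi>) \<union> vars (subst \<sigma> \<chi>)"
    using fresh_var by blast
  moreover have "subst (\<sigma>(p := Var q)) \<phi> = subst \<sigma> \<phi>" "subst (\<sigma>(p := Var q)) \<psi> = subst \<sigma> \<psi>"
    "subst (\<sigma>(p := Var q)) \<chi> = subst \<sigma> \<chi>"
    using rho6.hyps by (simp_all add: subst_upd del: fun_upd_apply)
  ultimately show ?case
    using rho6.IH[of "\<sigma>(p := Var q)"] MS2IC_u.rho6[of "subst \<sigma> \<phi>" q "subst \<sigma> \<psi>" "subst \<sigma> \<chi>"]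
    by (simp only: subst.simps fun_upd_same Un_iff simp_thms)
next
  case (rho7 p \<phi> \<chi>)
  obtain q where "q \<notin> vars (subst \<sigma> \<phi>) \<union> vars (subst \<sigma> \<phi>) \<union> vars (subst \<sigma> \<chi>)"
    using fresh_var by blast
  moreover have "subst (\<sigma>(p := Var q)) \<phi> = subst \<sigma> \<phi>" "subst (\<sigma>(p := Var q)) \<chi> = subst \<sigma> \<chi>"
    using rho7.hyps by (simp_all add: subst_upd del: fun_upd_apply)
  ultimately show ?case
    using rho7.IH[of "\<sigma>(p := Var q)"] MS2IC_u.rho7[of q "subst \<sigma> \<phi>" "subst \<sigma> \<chi>"]
    by (simp only: subst.simps fun_upd_same Un_iff simp_thms)
next
  case (UC p \<phi> \<psi>)
  obtain q where "q \<notin> vars (subst \<sigma> \<phi>) \<union> vars (subst \<sigma> \<phi>) \<union> vars (subst \<sigma> \<psi>)"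
    using fresh_var by blast
  moreover have "subst (\<sigma>(p := Var q)) \<phi> = subst \<sigma> \<phi>" "subst (\<sigma>(p := Var q)) \<psi> = subst \<sigma> \<psi>"
    using UC.hyps by (simp_all add: subst_upd del: fun_upd_apply)
  ultimately show ?case
    using UC.IH[of "\<sigma>(p := Var q)"] MS2IC_u.UC[of q "subst \<sigma> \<phi>" "subst \<sigma> \<psi>"]
    by (simp only: subst.simps fun_upd_same Un_iff simp_thms)
qed (auto intro: MS2IC_u.intros)

text \<open>By \<open>RE\<close> the formula \<open>\<phi>\<close> may be replaced by its
  disjunction with \<open>\<phi>'\<close>, and \<open>\<psi>\<close> by its conjunction with
  \<open>\<psi>'\<close>; then \<open>A2\<close> and \<open>A3\<close> split off the weakened strict
  implication.\<close>

lemma SImp_mono_thm: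
  assumes "MS2IC_u (\<phi>' \<^bold>\<rightarrow> \<phi>)" "MS2IC_u (\<psi> \<^bold>\<rightarrow> \<psi>')"
  shows "MS2IC_u ((\<phi> \<leadsto> \<psi>) \<^bold>\<rightarrow> (\<phi>' \<leadsto> \<psi>'))"
proof -
  have "MS2IC_u (\<phi> \<^bold>\<leftrightarrow> (\<phi>' \<^bold>\<or> \<phi>))"
    by (rule MS2IC_u_consequence[of "[\<phi>' \<^bold>\<rightarrow> \<phi>]"]) (use assms in auto)
  moreover have "MS2IC_u (\<psi> \<^bold>\<leftrightarrow> (\<psi> \<^bold>\<and> \<psi>'))"
    by (rule MS2IC_u_consequence[of "[\<psi> \<^bold>\<rightarrow> \<psi>']"]) (use assms in auto)
  ultimately have 1: "MS2IC_u ((\<phi> \<leadsto> \<psi>) \<^bold>\<leftrightarrow> ((\<phi>' \<^bold>\<or> \<phi>) \<leadsto> (\<psi> \<^bold>\<and> \<psi>')))"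
    by (rule RE)
  have 2: "MS2IC_u (((\<phi>' \<^bold>\<or> \<phi>) \<leadsto> (\<psi> \<^bold>\<and> \<psi>')) \<^bold>\<leftrightarrow>
      ((\<phi>' \<leadsto> (\<psi> \<^bold>\<and> \<psi>')) \<^bold>\<and> (\<phi> \<leadsto> (\<psi> \<^bold>\<and> \<psi>'))))"
    by (intro ax A2)
  have 3: "MS2IC_u ((\<phi>' \<leadsto> (\<psi> \<^bold>\<and> \<psi>')) \<^bold>\<leftrightarrow> ((\<phi>' \<leadsto> \<psi>) \<^bold>\<and> (\<phi>' \<leadsto> \<psi>')))"
    by (intro ax A3)
  \<comment> \<open>Here \<open>simplified\<close> turns the premise about the list into a
    conjunction, whose members are unified with the facts 1 to 3. What remains is a propositional
    goal about \<open>pval\<close>.\<close>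
  show ?thesis
    by (rule MS2IC_u_consequence[OF _, of "[_, _, _]", simplified,
      OF conjI[OF 1 conjI[OF 2 3]]]) auto
qed

text \<open>Monotonicity as a single formula, so that it can later be applied to an implication that
  merely belongs to a theory. Weakening the antecedent top gives \<open>\<phi> \<leadsto>\<close>
  the implication; \<open>A3\<close> joins it with \<open>\<phi> \<leadsto> \<psi>\<close>, and
  modus ponens takes place under the strict implication.\<close>

lemma SImp_right_Univ:
  "MS2IC_u (\<^bold>\<forall> (\<psi> \<^bold>\<rightarrow> \<psi>') \<^bold>\<and> (\<phi> \<leadsto> \<psi>) \<^bold>\<rightarrow> (\<phi> \<leadsto> \<psi>'))"
proof -
  have 1: "MS2IC_u (\<^bold>\<forall> (\<psi> \<^bold>\<rightarrow> \<psi>') \<^bold>\<rightarrow> (\<phi> \<leadsto> (\<psi> \<^bold>\<rightarrow> \<psi>')))"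
    by (intro SImp_mono_thm MS2IC_u_prop_valid) auto
  have 2: "MS2IC_u ((\<phi> \<leadsto> (\<psi> \<^bold>\<and> (\<psi> \<^bold>\<rightarrow> \<psi>'))) \<^bold>\<leftrightarrow> ((\<phi> \<leadsto> \<psi>) \<^bold>\<and> (\<phi> \<leadsto> (\<psi> \<^bold>\<rightarrow> \<psi>'))))"
    by (intro ax A3)
  have 3: "MS2IC_u ((\<phi> \<leadsto> (\<psi> \<^bold>\<and> (\<psi> \<^bold>\<rightarrow> \<psi>'))) \<^bold>\<rightarrow> (\<phi> \<leadsto> \<psi>'))"
    by (intro SImp_mono_thm MS2IC_u_prop_valid) auto
  show ?thesis
    by (rule MS2IC_u_consequence[OF _, of "[_, _, _]", simplified,
      OF conjI[OF 1 conjI[OF 2 3]]]) auto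
qed

lemma Univ_imp: "MS2IC_u (\<^bold>\<forall> \<phi> \<^bold>\<rightarrow> \<phi>)"
proof -
  have "MS2IC_u (\<^bold>\<forall> \<phi> \<^bold>\<rightarrow> (\<^bold>\<top> \<^bold>\<rightarrow> \<phi>))" by (intro ax A4)
  then show ?thesis
    by (rule_tac MS2IC_u_consequence[of "[\<^bold>\<forall> \<phi> \<^bold>\<rightarrow> (\<^bold>\<top> \<^bold>\<rightarrow> \<phi>)]"]) auto
qed

lemma Univ_mono: "MS2IC_u (\<phi> \<^bold>\<rightarrow> \<psi>) \<Longrightarrow> MS2IC_u (\<^bold>\<forall> \<phi> \<^bold>\<rightarrow> \<^bold>\<forall> \<psi>)"
  by (rule SImp_mono_thm[OF MS2IC_u_prop_valid]) auto

section \<open>The global consequence relation\<close>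

lemma pval_conj_list: "pval g (conj_list \<gamma>s) \<longleftrightarrow> (\<forall>\<gamma>\<in>set \<gamma>s. pval g \<gamma>)"
  by (induction \<gamma>s) auto

lemma vars_conj_list: "vars (conj_list \<gamma>s) = (\<Union>\<gamma>\<in>set \<gamma>s. vars \<gamma>)"
  by (induction \<gamma>s) auto

lemma subst_conj_list: "subst \<sigma> (conj_list \<gamma>s) = conj_list (map (subst \<sigma>) \<gamma>s)"
  by (induction \<gamma>s) auto

lemma Univ_conj_list_mono:
  "set \<gamma>s \<subseteq> set \<delta>s \<Longrightarrow> MS2IC_u (\<^bold>\<forall> (conj_list \<delta>s) \<^bold>\<rightarrow> \<^bold>\<forall> (conj_list \<gamma>s))"
  by (intro Univ_mono MS2IC_u_prop_valid) (auto simp: pval_conj_list)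

lemma derives_thm: "MS2IC_u \<phi> \<Longrightarrow> S \<turnstile>\<^sub>u \<phi>"
  unfolding derives_def
  by (intro exI[of _ "[]"] conjI, simp, rule MS2IC_u_consequence[of "[\<phi>]"]) auto

lemma derives_Univ_conj_list: "set \<gamma>s \<subseteq> S \<Longrightarrow> S \<turnstile>\<^sub>u \<^bold>\<forall> (conj_list \<gamma>s)"
  unfolding derives_def by (intro exI[of _ \<gamma>s]) (auto intro: MS2IC_u_prop_valid)

lemma derives_MP:
  assumes "S \<turnstile>\<^sub>u (\<phi> \<^bold>\<rightarrow> \<psi>)" "S \<turnstile>\<^sub>u \<phi>"
  shows "S \<turnstile>\<^sub>u \<psi>"
proof -
  obtain \<gamma>s \<delta>s where s: "set \<gamma>s \<subseteq> S" "set \<delta>s \<subseteq> S"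
    and 1: "MS2IC_u (\<^bold>\<forall> (conj_list \<gamma>s) \<^bold>\<rightarrow> (\<phi> \<^bold>\<rightarrow> \<psi>))" and 2: "MS2IC_u (\<^bold>\<forall> (conj_list \<delta>s) \<^bold>\<rightarrow> \<phi>)"
    using assms unfolding derives_def by blast
  have 3: "MS2IC_u (\<^bold>\<forall> (conj_list (\<gamma>s @ \<delta>s)) \<^bold>\<rightarrow> \<^bold>\<forall> (conj_list \<gamma>s))"
    and 4: "MS2IC_u (\<^bold>\<forall> (conj_list (\<gamma>s @ \<delta>s)) \<^bold>\<rightarrow> \<^bold>\<forall> (conj_list \<delta>s))"
    by (rule Univ_conj_list_mono; simp)+
  have "MS2IC_u (\<^bold>\<forall> (conj_list (\<gamma>s @ \<delta>s)) \<^bold>\<rightarrow> \<psi>)"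
    by (rule MS2IC_u_consequence[OF _, of "[_, _, _, _]", simplified,
          OF conjI[OF 1 conjI[OF 2 conjI[OF 3 4]]]]) auto
  then show ?thesis unfolding derives_def using s by (intro exI[of _ "\<gamma>s @ \<delta>s"]) auto
qed

lemma derives_consequence:
  assumes "\<forall>\<alpha>\<in>set \<alpha>s. S \<turnstile>\<^sub>u \<alpha>" "\<And>g. \<forall>\<alpha>\<in>set \<alpha>s. pval g \<alpha> \<Longrightarrow> pval g \<beta>"
  shows "S \<turnstile>\<^sub>u \<beta>"
  using prop_consequence_closed[of "Collect (derives S)" \<alpha>s \<beta>] assms derives_thm derives_MP by auto

text \<open>The premises stand under \<open>Univ\<close> already, and \<open>A8\<close> supplies the
  second one.\<close>

lemma derives_Univ:
  assumes "S \<turnstile>\<^sub>u \<phi>"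
  shows "S \<turnstile>\<^sub>u \<^bold>\<forall> \<phi>"
proof -
  obtain \<gamma>s where s: "set \<gamma>s \<subseteq> S" and 1: "MS2IC_u (\<^bold>\<forall> (conj_list \<gamma>s) \<^bold>\<rightarrow> \<phi>)"
    using assms unfolding derives_def by blast
  have 2: "MS2IC_u (\<^bold>\<forall> (conj_list \<gamma>s) \<^bold>\<rightarrow> \<^bold>\<forall> (\<^bold>\<forall> (conj_list \<gamma>s)))" by (intro ax A8)
  have "MS2IC_u (\<^bold>\<forall> (conj_list \<gamma>s) \<^bold>\<rightarrow> \<^bold>\<forall> \<phi>)"
    by (rule MS2IC_u_consequence[OF _, of "[_, _]", simplified,
      OF conjI[OF Univ_mono[OF 1] 2]]) auto
  then show ?thesis unfolding derives_def using s by blast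
qed

lemma derives_mem: "\<phi> \<in> S \<Longrightarrow> S \<turnstile>\<^sub>u \<phi>"
proof -
  assume "\<phi> \<in> S"
  then have "S \<turnstile>\<^sub>u \<^bold>\<forall> (conj_list [\<phi>])" by (intro derives_Univ_conj_list) auto
  then have "S \<turnstile>\<^sub>u conj_list [\<phi>]" using derives_MP derives_thm Univ_imp by blast
  then show ?thesis by (rule_tac derives_consequence[of "[conj_list [\<phi>]]"]) auto
qed

lemma derives_mono: "S \<turnstile>\<^sub>u \<phi> \<Longrightarrow> S \<subseteq> S' \<Longrightarrow> S' \<turnstile>\<^sub>u \<phi>"
  unfolding derives_def by blast

text \<open>The premises used from \<open>S\<close> and the premise \<open>\<alpha>\<close> share
  one \<open>Univ\<close>, which \<open>A3\<close> with antecedent top splits into two; all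
  occurrences of \<open>\<alpha>\<close> are first gathered at the head of the list.\<close>

lemma derives_deduction:
  assumes "insert \<alpha> S \<turnstile>\<^sub>u \<beta>"
  shows "S \<turnstile>\<^sub>u (\<^bold>\<forall> \<alpha> \<^bold>\<rightarrow> \<beta>)"
proof -
  obtain \<gamma>s where s: "set \<gamma>s \<subseteq> insert \<alpha> S" and 1: "MS2IC_u (\<^bold>\<forall> (conj_list \<gamma>s) \<^bold>\<rightarrow> \<beta>)"
    using assms unfolding derives_def by blast
  define \<delta>s where "\<delta>s = filter (\<lambda>\<gamma>. \<gamma> \<noteq> \<alpha>) \<gamma>s"
  have 2: "MS2IC_u (\<^bold>\<forall> (conj_list (\<alpha> # \<delta>s)) \<^bold>\<rightarrow> \<^bold>\<forall> (conj_list \<gamma>s))"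
    by (rule Univ_conj_list_mono) (auto simp: \<delta>s_def)
  have 3: "MS2IC_u (\<^bold>\<forall> (conj_list (\<alpha> # \<delta>s)) \<^bold>\<leftrightarrow> (\<^bold>\<forall> \<alpha> \<^bold>\<and> \<^bold>\<forall> (conj_list \<delta>s)))"
    by (simp, intro ax A3)
  have "MS2IC_u (\<^bold>\<forall> (conj_list \<delta>s) \<^bold>\<rightarrow> (\<^bold>\<forall> \<alpha> \<^bold>\<rightarrow> \<beta>))"
    by (rule MS2IC_u_consequence[OF _, of "[_, _, _]", simplified,
      OF conjI[OF 1 conjI[OF 2 3, simplified]]]) auto
  then show ?thesis unfolding derives_def using s by (intro exI[of _ \<delta>s]) (auto simp: \<delta>s_def)
qed

lemma derives_subst:
  assumes "S \<turnstile>\<^sub>u \<phi>"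
  shows "subst \<sigma> ` S \<turnstile>\<^sub>u subst \<sigma> \<phi>"
proof -
  obtain \<gamma>s where s: "set \<gamma>s \<subseteq> S" and 1: "MS2IC_u (\<^bold>\<forall> (conj_list \<gamma>s) \<^bold>\<rightarrow> \<phi>)"
    using assms unfolding derives_def by blast
  from MS2IC_u_subst[OF 1, of \<sigma>] s show ?thesis
    unfolding derives_def by (intro exI[of _ "map (subst \<sigma>) \<gamma>s"]) (auto simp: subst_conj_list)
qed

section \<open>Witnesses and the Henkin construction\<close>

abbreviation consistent :: "fm set \<Rightarrow> bool" where
  "consistent S \<equiv> \<not> S \<turnstile>\<^sub>u \<^bold>\<bottom>"

lemma consistent_no_contradiction: "consistent S \<Longrightarrow> S \<turnstile>\<^sub>u \<phi> \<Longrightarrow> \<not> S \<turnstile>\<^sub>u (\<^bold>\<not> \<phi>)"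
  using derives_consequence[of "[\<phi>, \<^bold>\<not> \<phi>]" S "\<^bold>\<bottom>"] by auto

text \<open>The first three patterns belong to \<open>rho6\<close>, \<open>rho7\<close> and
  \<open>UC\<close>. The second formula says that \<open>\<phi>\<close> is non-zero in the algebra
  of the theory, the third that the box of \<open>\<phi>\<close> is not below \<open>\<psi>\<close>;
  the witness says the same of a variable that strictly implies \<open>\<phi>\<close>.\<close>

fun witness :: "fm \<Rightarrow> nat \<Rightarrow> fm" where
  "witness (\<phi> \<leadsto> \<psi>) p = (\<phi> \<leadsto> Var p) \<^bold>\<and> (Var p \<leadsto> \<psi>)"
| "witness (\<^bold>\<not> (\<^bold>\<forall> (\<^bold>\<not> \<phi>))) p = (Var p \<leadsto> \<phi>) \<^bold>\<and> (\<^bold>\<not> (\<^bold>\<forall> (\<^bold>\<not> (Var p))))"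
| "witness (\<^bold>\<not> (\<^bold>\<forall> (\<^bold>\<box> \<phi> \<^bold>\<rightarrow> \<psi>))) p = (Var p \<leadsto> \<phi>) \<^bold>\<and> (\<^bold>\<not> (\<^bold>\<forall> (\<^bold>\<box> (Var p) \<^bold>\<rightarrow> \<psi>)))"
| "witness _ p = \<^bold>\<top>"

lemma Univ_conj_intro:
  assumes "MS2IC_u (\<alpha> \<^bold>\<rightarrow> \<^bold>\<forall> \<alpha>)" "MS2IC_u (\<beta> \<^bold>\<rightarrow> \<^bold>\<forall> \<beta>)"
  shows "MS2IC_u (\<alpha> \<^bold>\<and> \<beta> \<^bold>\<rightarrow> \<^bold>\<forall> (\<alpha> \<^bold>\<and> \<beta>))"
proof -
  have "MS2IC_u (\<^bold>\<forall> (\<alpha> \<^bold>\<and> \<beta>) \<^bold>\<leftrightarrow> (\<^bold>\<forall> \<alpha> \<^bold>\<and> \<^bold>\<forall> \<beta>))" by (intro ax A3)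
  then show ?thesis
    using assms by (rule_tac MS2IC_u_consequence[of "[\<alpha> \<^bold>\<rightarrow> \<^bold>\<forall> \<alpha>, \<beta> \<^bold>\<rightarrow> \<^bold>\<forall> \<beta>,
      \<^bold>\<forall> (\<alpha> \<^bold>\<and> \<beta>) \<^bold>\<leftrightarrow> (\<^bold>\<forall> \<alpha> \<^bold>\<and> \<^bold>\<forall> \<beta>)]"]) auto
qed

lemma SImp_imp_Univ: "MS2IC_u ((\<phi> \<leadsto> \<psi>) \<^bold>\<rightarrow> \<^bold>\<forall> (\<phi> \<leadsto> \<psi>))"
proof -
  have "MS2IC_u ((\<phi> \<leadsto> \<psi>) \<^bold>\<leftrightarrow> \<^bold>\<forall> (\<phi> \<leadsto> \<psi>))" by (intro ax A10)
  then show ?thesis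
    by (rule_tac MS2IC_u_consequence[of "[(\<phi> \<leadsto> \<psi>) \<^bold>\<leftrightarrow> \<^bold>\<forall> (\<phi> \<leadsto> \<psi>)]"]) auto
qed

lemma Top_imp_Univ_Top: "MS2IC_u (\<^bold>\<top> \<^bold>\<rightarrow> \<^bold>\<forall> \<^bold>\<top>)"
proof -
  have "MS2IC_u (\<^bold>\<forall> \<^bold>\<top>)" by (intro R MS2IC_u_prop_valid) simp
  then show ?thesis by (rule_tac MS2IC_u_consequence[of "[\<^bold>\<forall> \<^bold>\<top>]"]) auto
qed

text \<open>Witnesses are conjunctions of strict implications and negated \<open>Univ\<close>
  formulas, for which \<open>A10\<close> and \<open>A9\<close> apply. This removes the
  \<open>Univ\<close> that the deduction theorem puts in front of a witness.\<close>

lemma witness_imp_Univ: "MS2IC_u (witness \<alpha> p \<^bold>\<rightarrow> \<^bold>\<forall> (witness \<alpha> p))"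
proof (cases "(\<alpha>, p)" rule: witness.cases)
qed (auto simp del: fm.inject intro!: Univ_conj_intro SImp_imp_Univ ax[OF A9] Top_imp_Univ_Top)

text \<open>If the witness were inconsistent with \<open>S\<close>, it would provably refute
  \<open>\<theta>\<close>, which gathers the finitely many members of \<open>S\<close> involved and
  does not contain \<open>p\<close>. The matching rule eliminates \<open>p\<close>, and then
  \<open>S\<close> refutes \<open>\<theta>\<close> or \<open>\<alpha>\<close>, both of which it
  derives.\<close>

lemma consistent_witness:
  assumes con: "consistent S" and mem: "\<alpha> \<in> S" and fresh: "p \<notin> (\<Union>\<gamma>\<in>S. vars \<gamma>)"
  shows "consistent (insert (witness \<alpha> p) S)"
proof
  let ?\<beta> = "witness \<alpha> p"
  assume "insert ?\<beta> S \<turnstile>\<^sub>u \<^bold>\<bottom>"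
  from derives_deduction[OF this] obtain \<gamma>s where s: "set \<gamma>s \<subseteq> S"
    and th: "MS2IC_u (\<^bold>\<forall> (conj_list \<gamma>s) \<^bold>\<rightarrow> (\<^bold>\<forall> ?\<beta> \<^bold>\<rightarrow> \<^bold>\<bottom>))"
    unfolding derives_def by blast
  define \<theta> where "\<theta> = \<^bold>\<forall> (conj_list \<gamma>s)"
  have S\<theta>: "S \<turnstile>\<^sub>u \<theta>" unfolding \<theta>_def using s by (rule derives_Univ_conj_list)
  have p\<theta>: "p \<notin> vars \<theta>" using fresh s by (auto simp: \<theta>_def vars_conj_list)
  have p\<alpha>: "p \<notin> vars \<alpha>" using fresh mem by blast
  have S\<alpha>: "S \<turnstile>\<^sub>u \<alpha>" using mem by (rule derives_mem)
  have b: "MS2IC_u (?\<beta> \<^bold>\<rightarrow> \<^bold>\<not> \<theta>)"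
    by (rule MS2IC_u_consequence[of "[\<theta> \<^bold>\<rightarrow> (\<^bold>\<forall> ?\<beta> \<^bold>\<rightarrow> \<^bold>\<bottom>), ?\<beta> \<^bold>\<rightarrow> \<^bold>\<forall> ?\<beta>]"])
      (use th witness_imp_Univ in \<open>auto simp: \<theta>_def\<close>)
  have trivial: False if "?\<beta> = \<^bold>\<top>"
  proof -
    have "S \<turnstile>\<^sub>u (\<^bold>\<top> \<^bold>\<rightarrow> \<^bold>\<not> \<theta>)" using derives_thm[OF b] that by simp
    then have "S \<turnstile>\<^sub>u (\<^bold>\<not> \<theta>)" by (rule_tac derives_consequence[of "[\<^bold>\<top> \<^bold>\<rightarrow> \<^bold>\<not> \<theta>]"]) auto
    then show False using consistent_no_contradiction[OF con S\<theta>] by simp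
  qed
  show False
  proof (cases "(\<alpha>, p)" rule: witness.cases)
    case (1 \<phi> \<psi> p')
    then have "MS2IC_u ((\<phi> \<leadsto> \<psi>) \<^bold>\<rightarrow> \<^bold>\<not> \<theta>)"
      using b p\<theta> p\<alpha> by (rule_tac rho6[of \<phi> p]) auto
    from derives_MP[OF derives_thm[OF this]] have "S \<turnstile>\<^sub>u (\<^bold>\<not> \<theta>)" using S\<alpha> 1 by simp
    then show ?thesis using consistent_no_contradiction[OF con S\<theta>] by simp
  next
    case (2 \<phi> p')
    \<comment> \<open>The second conjunct of the witness is weakened to \<open>p\<close> itself: by
      \<open>Univ_imp\<close>, \<open>p\<close> refutes the \<open>Univ\<close> of its own negation.
      After \<open>rho7\<close>, \<open>S\<close> derives the negation of \<open>\<phi>\<close>,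
      hence its \<open>Univ\<close>, against \<open>\<alpha>\<close>.\<close>
    have "MS2IC_u ((Var p \<leadsto> \<phi>) \<^bold>\<and> Var p \<^bold>\<rightarrow> \<^bold>\<not> \<theta>)"
      by (rule MS2IC_u_consequence[of "[?\<beta> \<^bold>\<rightarrow> \<^bold>\<not> \<theta>, \<^bold>\<forall> (\<^bold>\<not> (Var p)) \<^bold>\<rightarrow> \<^bold>\<not> (Var p)]"])
        (use b Univ_imp 2 in auto)
    then have "MS2IC_u (\<phi> \<^bold>\<rightarrow> \<^bold>\<not> \<theta>)" using p\<theta> p\<alpha> 2 by (rule_tac rho7[of p]) auto
    then have "S \<turnstile>\<^sub>u (\<^bold>\<not> \<phi>)"
      using S\<theta> derives_thm by (intro derives_consequence[of "[\<phi> \<^bold>\<rightarrow> \<^bold>\<not> \<theta>, \<theta>]"]) auto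
    from consistent_no_contradiction[OF con derives_Univ[OF this]] show ?thesis using S\<alpha> 2 by simp
  next
    case (3 \<phi> \<psi> p')
    \<comment> \<open>The rule \<open>UC\<close> is applied with the conclusion
      \<open>\<theta> \<rightarrow> \<psi>\<close>. If \<open>\<theta>\<close> holds, the witness
      fails, so \<open>p \<leadsto> \<phi>\<close> forces the box of \<open>p\<close> to imply
      \<open>\<psi>\<close>.\<close>
    have "MS2IC_u ((Var p \<leadsto> \<phi>) \<^bold>\<and> \<^bold>\<box> (Var p) \<^bold>\<rightarrow> (\<theta> \<^bold>\<rightarrow> \<psi>))"
      by (rule MS2IC_u_consequence[of "[?\<beta> \<^bold>\<rightarrow> \<^bold>\<not> \<theta>, \<^bold>\<forall> (\<^bold>\<box> (Var p) \<^bold>\<rightarrow> \<psi>) \<^bold>\<rightarrow> (\<^bold>\<box> (Var p) \<^bold>\<rightarrow> \<psi>)]"])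
        (use b Univ_imp 3 in auto)
    then have "MS2IC_u (\<^bold>\<box> \<phi> \<^bold>\<rightarrow> (\<theta> \<^bold>\<rightarrow> \<psi>))" using p\<theta> p\<alpha> 3 by (rule_tac UC[of p]) auto
    then have "S \<turnstile>\<^sub>u (\<^bold>\<box> \<phi> \<^bold>\<rightarrow> \<psi>)"
      using S\<theta> derives_thm by (intro derives_consequence[of "[\<^bold>\<box> \<phi> \<^bold>\<rightarrow> (\<theta> \<^bold>\<rightarrow> \<psi>), \<theta>]"]) auto
    from consistent_no_contradiction[OF con derives_Univ[OF this]] show ?thesis using S\<alpha> 3 by simp
  qed (use trivial in simp_all)
qed

definition fresh :: "fm set \<Rightarrow> nat" where
  "fresh S = (SOME p. p \<notin> (\<Union>\<gamma>\<in>S. vars \<gamma>))"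

text \<open>A rejected formula is simply skipped. Adding its negation would be too strong, since
  members are read under \<open>Univ\<close>; the decisions needed follow from the deduction
  theorem.\<close>

definition henkin_step :: "fm set \<Rightarrow> fm \<Rightarrow> fm set" where
  "henkin_step S \<alpha> = (if consistent (insert \<alpha> S)
     then insert (witness \<alpha> (fresh (insert \<alpha> S))) (insert \<alpha> S) else S)"

primrec henkin_chain :: "fm set \<Rightarrow> nat \<Rightarrow> fm set" where
  "henkin_chain S 0 = S"
| "henkin_chain S (Suc n) = henkin_step (henkin_chain S n) (from_nat n)"

definition many_fresh :: "fm set \<Rightarrow> bool" where
  "many_fresh S \<longleftrightarrow> infinite (- (\<Union>\<gamma>\<in>S. vars \<gamma>))"

lemma many_fresh_insert: "many_fresh S \<Longrightarrow> many_fresh (insert \<alpha> S)"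
  unfolding many_fresh_def
  using Diff_infinite_finite[OF vars_finite[of \<alpha>], of "- (\<Union>\<gamma>\<in>S. vars \<gamma>)"]
  by (simp add: Compl_Un Diff_eq Int_commute)

lemma fresh_notin: "many_fresh S \<Longrightarrow> fresh S \<notin> (\<Union>\<gamma>\<in>S. vars \<gamma>)"
  unfolding many_fresh_def fresh_def
  by (rule someI_ex) (metis ComplD finite.emptyI ex_in_conv)

lemma henkin_step_invariant:
  assumes "consistent S" "many_fresh S"
  shows "consistent (henkin_step S \<alpha>) \<and> many_fresh (henkin_step S \<alpha>)"
proof (cases "consistent (insert \<alpha> S)")
  case True
  then have "consistent (henkin_step S \<alpha>)"
    unfolding henkin_step_def
    using consistent_witness[OF True insertI1 fresh_notin[OF many_fresh_insert[OF assms(2)]]] by simp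
  with True show ?thesis using assms(2) by (simp add: henkin_step_def many_fresh_insert)
qed (use assms in \<open>simp add: henkin_step_def\<close>)

lemma henkin_chain_invariant:
  assumes "consistent S" "many_fresh S"
  shows "consistent (henkin_chain S n) \<and> many_fresh (henkin_chain S n)"
  using assms by (induction n) (auto simp: henkin_step_invariant)

lemma henkin_chain_mono: "m \<le> n \<Longrightarrow> henkin_chain S m \<subseteq> henkin_chain S n"
  by (rule lift_Suc_mono_le) (auto simp: henkin_step_def)

lemma finite_subset_chain:
  assumes "finite A" "A \<subseteq> (\<Union>n. henkin_chain S n)"
  shows "\<exists>n. A \<subseteq> henkin_chain S n"
  using assms
proof (induction A)
  case (insert a A)
  then obtain m n where "a \<in> henkin_chain S m" "A \<subseteq> henkin_chain S n" by auto
  then show ?case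
    using henkin_chain_mono[of m "max m n" S] henkin_chain_mono[of n "max m n" S] by fastforce
qed auto

text \<open>Read in the Lindenbaum algebra of \<open>T\<close>, an implication outside
  \<open>T\<close> is a failing inequality. The last three conditions thus provide interpolants,
  non-zero elements preceding a non-zero element, and upper continuity in its dual form for the
  box.\<close>

locale saturated_theory =
  fixes T :: "fm set"
  assumes thm_mem: "MS2IC_u \<phi> \<Longrightarrow> \<phi> \<in> T"
    and mp_mem: "(\<phi> \<^bold>\<rightarrow> \<psi>) \<in> T \<Longrightarrow> \<phi> \<in> T \<Longrightarrow> \<psi> \<in> T"
    and Univ_mem: "\<phi> \<in> T \<Longrightarrow> \<^bold>\<forall> \<phi> \<in> T"
    and SImp_decided: "(\<phi> \<leadsto> \<psi>) \<notin> T \<Longrightarrow> \<^bold>\<not> (\<phi> \<leadsto> \<psi>) \<in> T"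
    and SImp_witness: "(\<phi> \<leadsto> \<psi>) \<in> T \<Longrightarrow> \<exists>\<chi>. (\<phi> \<leadsto> \<chi>) \<in> T \<and> (\<chi> \<leadsto> \<psi>) \<in> T"
    and nonzero_witness: "\<^bold>\<not> \<phi> \<notin> T \<Longrightarrow> \<exists>\<chi>. (\<chi> \<leadsto> \<phi>) \<in> T \<and> \<^bold>\<not> \<chi> \<notin> T"
    and Box_witness: "(\<^bold>\<box> \<phi> \<^bold>\<rightarrow> \<psi>) \<notin> T \<Longrightarrow> \<exists>\<chi>. (\<chi> \<leadsto> \<phi>) \<in> T \<and> (\<^bold>\<box> \<chi> \<^bold>\<rightarrow> \<psi>) \<notin> T"

lemma saturated_extension:
  assumes con: "consistent S" and mf: "many_fresh S"
  shows "\<exists>T. S \<subseteq> T \<and> consistent T \<and> saturated_theory T"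
proof -
  define T where "T = (\<Union>n. henkin_chain S n)"
  have sub: "henkin_chain S n \<subseteq> T" for n unfolding T_def by blast
  have conT: "consistent T"
  proof
    assume "T \<turnstile>\<^sub>u \<^bold>\<bottom>"
    then obtain \<gamma>s where g: "set \<gamma>s \<subseteq> T" "MS2IC_u (\<^bold>\<forall> (conj_list \<gamma>s) \<^bold>\<rightarrow> \<^bold>\<bottom>)"
      unfolding derives_def by blast
    obtain n where "set \<gamma>s \<subseteq> henkin_chain S n"
      using finite_subset_chain[of "set \<gamma>s" S] g(1) unfolding T_def by auto
    with g(2) have "henkin_chain S n \<turnstile>\<^sub>u \<^bold>\<bottom>" unfolding derives_def by blast
    then show False using henkin_chain_invariant[OF con mf] by blast
  qed
  \<comment> \<open>A formula consistent with all of \<open>T\<close> is consistent with the stage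
    numbered by its code, where it is then added with a witness. Contraposed, every formula outside
    \<open>T\<close> is inconsistent with \<open>T\<close>; applied to a member of \<open>T\<close>,
    the fact yields its witness.\<close>
  have added: "\<alpha> \<in> T \<and> (\<exists>p. witness \<alpha> p \<in> T)" if "consistent (insert \<alpha> T)" for \<alpha>
  proof -
    have "consistent (insert \<alpha> (henkin_chain S (to_nat \<alpha>)))"
      using that derives_mono sub by (meson insert_mono)
    then have "{\<alpha>, witness \<alpha> (fresh (insert \<alpha> (henkin_chain S (to_nat \<alpha>))))}
        \<subseteq> henkin_chain S (Suc (to_nat \<alpha>))"
      by (simp add: henkin_step_def)
    then show ?thesis using sub by blast
  qed
  have closed: "\<alpha> \<in> T" if "T \<turnstile>\<^sub>u \<alpha>" for \<alpha>
  proof (rule ccontr)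
    assume "\<alpha> \<notin> T"
    then have "insert \<alpha> T \<turnstile>\<^sub>u \<^bold>\<bottom>" using added by blast
    from derives_MP[OF derives_deduction[OF this] derives_Univ[OF that]] show False
      using conT by simp
  qed
  have iff: "\<alpha> \<in> T \<longleftrightarrow> T \<turnstile>\<^sub>u \<alpha>" for \<alpha> using closed derives_mem by blast
  have wit: "\<exists>p. witness \<alpha> p \<in> T" if "\<alpha> \<in> T" for \<alpha>
    using added[of \<alpha>] conT that by (simp add: insert_absorb)
  have conjD: "\<alpha> \<in> T \<and> \<beta> \<in> T" if "\<alpha> \<^bold>\<and> \<beta> \<in> T" for \<alpha> \<beta>
    using that unfolding iff by (intro conjI; rule_tac derives_consequence[of "[\<alpha> \<^bold>\<and> \<beta>]"]) auto
  have dec: "\<^bold>\<not> (\<phi> \<leadsto> \<psi>) \<in> T" if "(\<phi> \<leadsto> \<psi>) \<notin> T" for \<phi> \<psi>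
  proof -
    have "insert (\<phi> \<leadsto> \<psi>) T \<turnstile>\<^sub>u \<^bold>\<bottom>" using added that by blast
    from derives_deduction[OF this] show ?thesis
      unfolding iff using derives_thm[OF SImp_imp_Univ, of T \<phi> \<psi>]
      by (intro derives_consequence[of "[\<^bold>\<forall> (\<phi> \<leadsto> \<psi>) \<^bold>\<rightarrow> \<^bold>\<bottom>, (\<phi> \<leadsto> \<psi>) \<^bold>\<rightarrow> \<^bold>\<forall> (\<phi> \<leadsto> \<psi>)]"]) auto
  qed
  \<comment> \<open>Translates the negated \<open>Univ\<close> formulas, on which
    \<open>witness\<close> acts, into the non-membership form used in
    \<open>saturated_theory\<close>.\<close>
  have notUniv: "\<^bold>\<not> (\<^bold>\<forall> \<phi>) \<in> T \<longleftrightarrow> \<phi> \<notin> T" for \<phi>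
  proof
    assume "\<phi> \<notin> T"
    then have "\<^bold>\<forall> \<phi> \<notin> T" unfolding iff using derives_MP[OF derives_thm[OF Univ_imp], of T \<phi>] by auto
    then show "\<^bold>\<not> (\<^bold>\<forall> \<phi>) \<in> T" by (rule dec)
  next
    assume "\<^bold>\<not> (\<^bold>\<forall> \<phi>) \<in> T"
    then show "\<phi> \<notin> T"
      unfolding iff using consistent_no_contradiction[OF conT derives_Univ, of \<phi>] by auto
  qed
  have "saturated_theory T"
  proof
    show "MS2IC_u \<phi> \<Longrightarrow> \<phi> \<in> T" for \<phi> using iff derives_thm by blast
    show "(\<phi> \<^bold>\<rightarrow> \<psi>) \<in> T \<Longrightarrow> \<phi> \<in> T \<Longrightarrow> \<psi> \<in> T" for \<phi> \<psi> using iff derives_MP by blast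
    show "\<phi> \<in> T \<Longrightarrow> \<^bold>\<forall> \<phi> \<in> T" for \<phi> using iff derives_Univ by blast
    show "(\<phi> \<leadsto> \<psi>) \<notin> T \<Longrightarrow> \<^bold>\<not> (\<phi> \<leadsto> \<psi>) \<in> T" for \<phi> \<psi> by (rule dec)
    show "\<exists>\<chi>. (\<phi> \<leadsto> \<chi>) \<in> T \<and> (\<chi> \<leadsto> \<psi>) \<in> T" if "(\<phi> \<leadsto> \<psi>) \<in> T" for \<phi> \<psi>
      using wit[OF that] by (auto dest!: conjD)
    show "\<exists>\<chi>. (\<chi> \<leadsto> \<phi>) \<in> T \<and> \<^bold>\<not> \<chi> \<notin> T" if "\<^bold>\<not> \<phi> \<notin> T" for \<phi>
      using wit[of "\<^bold>\<not> (\<^bold>\<forall> (\<^bold>\<not> \<phi>))"] that by (auto simp: notUniv dest!: conjD)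
    show "\<exists>\<chi>. (\<chi> \<leadsto> \<phi>) \<in> T \<and> (\<^bold>\<box> \<chi> \<^bold>\<rightarrow> \<psi>) \<notin> T" if "(\<^bold>\<box> \<phi> \<^bold>\<rightarrow> \<psi>) \<notin> T" for \<phi> \<psi>
      using wit[of "\<^bold>\<not> (\<^bold>\<forall> (\<^bold>\<box> \<phi> \<^bold>\<rightarrow> \<psi>))"] that by (auto simp: notUniv dest!: conjD)
  qed
  then show ?thesis using conT sub[of 0] by auto
qed

lemma vars_subst: "vars (subst \<sigma> \<phi>) = (\<Union>p\<in>vars \<phi>. vars (\<sigma> p))"
  by (induction \<phi>) auto

lemma exists_saturated_countertheory:
  assumes "\<not> \<Gamma> \<turnstile>\<^sub>u \<phi>"
  shows "\<exists>T \<sigma>. saturated_theory T \<and> (\<forall>\<gamma>\<in>\<Gamma>. subst \<sigma> \<gamma> \<in> T) \<and> subst \<sigma> \<phi> \<notin> T"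
proof -
  \<comment> \<open>Doubling frees the odd variables for witnesses, and halving is a left inverse
    that carries a derivation back to \<open>\<Gamma>\<close> and \<open>\<phi>\<close>.\<close>
  define \<sigma> where "\<sigma> = (\<lambda>p. Var (2 * p))"
  define \<tau> where "\<tau> = (\<lambda>p. Var (p div 2))"
  have \<tau>\<sigma>: "subst \<tau> (subst \<sigma> \<gamma>) = \<gamma>" for \<gamma>
    by (simp add: subst_subst \<sigma>_def \<tau>_def subst_Var)
  \<comment> \<open>Since members of \<open>S\<close> are read under \<open>Univ\<close>, the bare
    negation of the renamed \<open>\<phi>\<close> would demand the value bottom. A countermodel only
    needs a value different from top, which negating its \<open>Univ\<close> expresses.\<close>
  define S where "S = insert (\<^bold>\<not> (\<^bold>\<forall> (subst \<sigma> \<phi>))) (subst \<sigma> ` \<Gamma>)"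
  have "consistent S"
  proof
    assume "S \<turnstile>\<^sub>u \<^bold>\<bottom>"
    from derives_deduction[OF this[unfolded S_def]]
    have "subst \<sigma> ` \<Gamma> \<turnstile>\<^sub>u subst \<sigma> \<phi>"
      using derives_thm[OF ax[OF A9], of _ "subst \<sigma> \<phi>"] derives_thm[OF Univ_imp, of _ "subst \<sigma> \<phi>"]
      by (intro derives_consequence[of "[\<^bold>\<forall> (\<^bold>\<not> (\<^bold>\<forall> (subst \<sigma> \<phi>))) \<^bold>\<rightarrow> \<^bold>\<bottom>,
            \<^bold>\<not> (\<^bold>\<forall> (subst \<sigma> \<phi>)) \<^bold>\<rightarrow> \<^bold>\<forall> (\<^bold>\<not> (\<^bold>\<forall> (subst \<sigma> \<phi>))), \<^bold>\<forall> (subst \<sigma> \<phi>) \<^bold>\<rightarrow> subst \<sigma> \<phi>]"]) auto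
    from derives_subst[OF this, of \<tau>] have "\<Gamma> \<turnstile>\<^sub>u \<phi>" by (simp add: image_image \<tau>\<sigma>)
    with assms show False ..
  qed
  moreover have "many_fresh S"
    unfolding many_fresh_def
  proof (rule infinite_super)
    show "range (\<lambda>n. Suc (2 * n)) \<subseteq> - (\<Union>\<gamma>\<in>S. vars \<gamma>)"
      by (auto simp: S_def vars_subst \<sigma>_def) presburger+
    show "infinite (range (\<lambda>n::nat. Suc (2 * n)))"
      using finite_imageD[of "\<lambda>n::nat. Suc (2 * n)" UNIV] by (auto simp: inj_def)
  qed
  ultimately obtain T where T: "S \<subseteq> T" "consistent T" "saturated_theory T"
    using saturated_extension by blast
  have "subst \<sigma> \<phi> \<notin> T"
  proof
    assume "subst \<sigma> \<phi> \<in> T"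
    then have "T \<turnstile>\<^sub>u \<^bold>\<forall> (subst \<sigma> \<phi>)" by (intro derives_Univ derives_mem)
    moreover have "T \<turnstile>\<^sub>u (\<^bold>\<not> (\<^bold>\<forall> (subst \<sigma> \<phi>)))" using T(1) by (intro derives_mem) (auto simp: S_def)
    ultimately show False using T(2) consistent_no_contradiction by blast
  qed
  with T show ?thesis unfolding S_def by blast
qed

section \<open>The canonical algebra\<close>

lemma (in partial_order) meet_eqI: "is_glb L z {x, y} \<Longrightarrow> x \<sqinter> y = z"
  unfolding meet_def Lattice.inf_def by (rule some_equality) (auto intro: greatest_unique)

lemma (in partial_order) join_eqI: "is_lub L z {x, y} \<Longrightarrow> x \<squnion> y = z"
  unfolding join_def Lattice.sup_def by (rule some_equality) (auto intro: least_unique)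

section \<open>Strict implication, box and diamond modulo a saturated theory\<close>

context saturated_theory
begin

lemma mem_consequence:
  assumes "\<forall>\<alpha>\<in>set \<alpha>s. \<alpha> \<in> T" "\<And>g. \<forall>\<alpha>\<in>set \<alpha>s. pval g \<alpha> \<Longrightarrow> pval g \<beta>"
  shows "\<beta> \<in> T"
  using prop_consequence_closed[of T \<alpha>s \<beta>] assms thm_mem mp_mem by auto

lemma mem_consequence0: "(\<And>g. pval g \<beta>) \<Longrightarrow> \<beta> \<in> T"
  by (rule mem_consequence[of "[]"]) auto

lemma mem_consequence1: "\<alpha> \<in> T \<Longrightarrow> (\<And>g. pval g \<alpha> \<Longrightarrow> pval g \<beta>) \<Longrightarrow> \<beta> \<in> T"
  by (rule mem_consequence[of "[\<alpha>]"]) auto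

lemma mem_consequence2:
  "\<alpha> \<in> T \<Longrightarrow> \<alpha>' \<in> T \<Longrightarrow> (\<And>g. pval g \<alpha> \<Longrightarrow> pval g \<alpha>' \<Longrightarrow> pval g \<beta>) \<Longrightarrow> \<beta> \<in> T"
  by (rule mem_consequence[of "[\<alpha>, \<alpha>']"]) auto

lemma Imp_trans: "(\<phi> \<^bold>\<rightarrow> \<psi>) \<in> T \<Longrightarrow> (\<psi> \<^bold>\<rightarrow> \<chi>) \<in> T \<Longrightarrow> (\<phi> \<^bold>\<rightarrow> \<chi>) \<in> T"
  by (erule mem_consequence2) auto

lemma Iff_mem:
  assumes "(\<phi> \<^bold>\<leftrightarrow> \<psi>) \<in> T"
  shows "\<phi> \<in> T \<longleftrightarrow> \<psi> \<in> T"
  using mem_consequence2[OF assms, of \<phi> \<psi>] mem_consequence2[OF assms, of \<psi> \<phi>] by auto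

lemma Conj_mem: "\<phi> \<^bold>\<and> \<psi> \<in> T \<longleftrightarrow> \<phi> \<in> T \<and> \<psi> \<in> T"
  using mem_consequence1[of "\<phi> \<^bold>\<and> \<psi>" \<phi>] mem_consequence1[of "\<phi> \<^bold>\<and> \<psi>" \<psi>]
    mem_consequence2[of \<phi> \<psi> "\<phi> \<^bold>\<and> \<psi>"] by auto

lemma SImp_contrapos: "(\<phi> \<leadsto> \<psi>) \<in> T \<longleftrightarrow> (\<^bold>\<not> \<psi> \<leadsto> \<^bold>\<not> \<phi>) \<in> T"
  by (rule Iff_mem[OF thm_mem[OF ax[OF A5]]])

lemma SImp_right_mono:
  assumes "(\<phi> \<leadsto> \<psi>) \<in> T" "(\<psi> \<^bold>\<rightarrow> \<psi>') \<in> T"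
  shows "(\<phi> \<leadsto> \<psi>') \<in> T"
  by (rule mem_consequence[of "[\<^bold>\<forall> (\<psi> \<^bold>\<rightarrow> \<psi>'), \<phi> \<leadsto> \<psi>, \<^bold>\<forall> (\<psi> \<^bold>\<rightarrow> \<psi>') \<^bold>\<and> (\<phi> \<leadsto> \<psi>) \<^bold>\<rightarrow> (\<phi> \<leadsto> \<psi>')]"])
    (use assms Univ_mem thm_mem SImp_right_Univ in auto)

lemma SImp_left_mono:
  assumes "(\<phi> \<leadsto> \<psi>) \<in> T" "(\<phi>' \<^bold>\<rightarrow> \<phi>) \<in> T"
  shows "(\<phi>' \<leadsto> \<psi>) \<in> T"
proof -
  have "(\<^bold>\<not> \<phi> \<^bold>\<rightarrow> \<^bold>\<not> \<phi>') \<in> T" using assms(2) by (rule mem_consequence1) auto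
  then show ?thesis using assms(1) SImp_right_mono SImp_contrapos by blast
qed

lemma SImp_mono:
  "\<lbrakk>(\<phi> \<leadsto> \<psi>) \<in> T; (\<phi>' \<^bold>\<rightarrow> \<phi>) \<in> T; (\<psi> \<^bold>\<rightarrow> \<psi>') \<in> T\<rbrakk> \<Longrightarrow> (\<phi>' \<leadsto> \<psi>') \<in> T"
  using SImp_left_mono SImp_right_mono by blast

lemma SImp_Conj:
  assumes "(\<phi> \<leadsto> \<psi>) \<in> T" "(\<phi>' \<leadsto> \<psi>') \<in> T"
  shows "((\<phi> \<^bold>\<and> \<phi>') \<leadsto> (\<psi> \<^bold>\<and> \<psi>')) \<in> T"
proof -
  have "(\<phi> \<^bold>\<and> \<phi>' \<^bold>\<rightarrow> \<phi>) \<in> T" "(\<phi> \<^bold>\<and> \<phi>' \<^bold>\<rightarrow> \<phi>') \<in> T" by (rule mem_consequence0; simp)+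
  then have "((\<phi> \<^bold>\<and> \<phi>') \<leadsto> \<psi>) \<^bold>\<and> ((\<phi> \<^bold>\<and> \<phi>') \<leadsto> \<psi>') \<in> T"
    using assms SImp_left_mono by (simp add: Conj_mem)
  then show ?thesis using Iff_mem[OF thm_mem[OF ax[OF A3]]] by blast
qed

lemma SImp_Disj:
  assumes "(\<phi> \<leadsto> \<psi>) \<in> T" "(\<phi>' \<leadsto> \<psi>') \<in> T"
  shows "((\<phi> \<^bold>\<or> \<phi>') \<leadsto> (\<psi> \<^bold>\<or> \<psi>')) \<in> T"
proof -
  have "(\<^bold>\<not> \<psi> \<^bold>\<and> \<^bold>\<not> \<psi>' \<leadsto> \<^bold>\<not> \<phi> \<^bold>\<and> \<^bold>\<not> \<phi>') \<in> T"
    using assms SImp_contrapos SImp_Conj by blast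
  then have "(\<^bold>\<not> (\<psi> \<^bold>\<or> \<psi>') \<leadsto> \<^bold>\<not> (\<phi> \<^bold>\<or> \<phi>')) \<in> T"
    by (rule SImp_mono; intro mem_consequence0) auto
  then show ?thesis using SImp_contrapos by blast
qed

lemma SImp_imp_mem:
  assumes "(\<phi> \<leadsto> \<psi>) \<in> T"
  shows "(\<phi> \<^bold>\<rightarrow> \<psi>) \<in> T"
  using mp_mem[OF thm_mem[OF ax[OF A4]] assms] .

lemma Bot_SImp: "(\<^bold>\<bottom> \<leadsto> \<phi>) \<in> T" and SImp_Top: "(\<phi> \<leadsto> \<^bold>\<top>) \<in> T"
  using thm_mem[OF ax[OF A1[of \<phi>]]] by (simp_all add: Conj_mem)

text \<open>The rule \<open>N\<close> covers theorems only. For a member of \<open>T\<close>,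
  \<open>Add\<close> is applied to \<open>Univ \<phi>\<close>, a strict implication with antecedent
  top, and the box of top is a theorem.\<close>

lemma Box_mem:
  assumes "\<phi> \<in> T"
  shows "\<^bold>\<box> \<phi> \<in> T"
proof -
  have "(\<^bold>\<box> \<^bold>\<top> \<leadsto> \<^bold>\<box> \<phi>) \<in> T"
    using mp_mem[OF thm_mem[OF ax[OF Add]] Univ_mem[OF assms]] .
  then show ?thesis
    using mp_mem[OF SImp_imp_mem] thm_mem[OF N[OF MS2IC_u_prop_valid]] by simp
qed

lemma Box_mp: "\<^bold>\<box> (\<phi> \<^bold>\<rightarrow> \<psi>) \<in> T \<Longrightarrow> (\<^bold>\<box> \<phi> \<^bold>\<rightarrow> \<^bold>\<box> \<psi>) \<in> T"
  using mp_mem[OF thm_mem[OF ax[OF K]]] .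

lemma Box_mono: "(\<phi> \<^bold>\<rightarrow> \<psi>) \<in> T \<Longrightarrow> (\<^bold>\<box> \<phi> \<^bold>\<rightarrow> \<^bold>\<box> \<psi>) \<in> T"
  using Box_mem Box_mp by blast

abbreviation Dia :: "fm \<Rightarrow> fm" where
  "Dia \<phi> \<equiv> \<^bold>\<not> (\<^bold>\<box> (\<^bold>\<not> \<phi>))"

lemma Dia_mono:
  assumes "(\<phi> \<^bold>\<rightarrow> \<psi>) \<in> T"
  shows "(Dia \<phi> \<^bold>\<rightarrow> Dia \<psi>) \<in> T"
proof -
  have "(\<^bold>\<not> \<psi> \<^bold>\<rightarrow> \<^bold>\<not> \<phi>) \<in> T" using assms by (rule mem_consequence1) auto
  from Box_mono[OF this] show ?thesis by (rule mem_consequence1) auto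
qed

lemma Dia_SImp: "(\<phi> \<leadsto> \<psi>) \<in> T \<Longrightarrow> (Dia \<phi> \<leadsto> Dia \<psi>) \<in> T"
  using mp_mem[OF thm_mem[OF ax[OF Add]]] SImp_contrapos by blast

lemma Dia_Disj: "(Dia (\<phi> \<^bold>\<or> \<psi>) \<^bold>\<rightarrow> Dia \<phi> \<^bold>\<or> Dia \<psi>) \<in> T"
proof -
  have "(\<^bold>\<not> \<phi> \<^bold>\<rightarrow> (\<^bold>\<not> \<psi> \<^bold>\<rightarrow> \<^bold>\<not> (\<phi> \<^bold>\<or> \<psi>))) \<in> T" by (rule mem_consequence0) auto
  from Box_mono[OF this] thm_mem[OF ax[OF K[of "\<^bold>\<not> \<psi>" "\<^bold>\<not> (\<phi> \<^bold>\<or> \<psi>)"]]]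
  show ?thesis by (rule mem_consequence2) auto
qed

lemma Dia_Bot: "(Dia \<^bold>\<bottom> \<^bold>\<rightarrow> \<^bold>\<bottom>) \<in> T"
proof -
  have "\<^bold>\<box> (\<^bold>\<not> \<^bold>\<bottom>) \<in> T" by (intro Box_mem mem_consequence0) auto
  then show ?thesis by (rule mem_consequence1) auto
qed

section \<open>Cuts of the Lindenbaum algebra as regular sets of formulas\<close>

definition down :: "fm \<Rightarrow> fm set" where
  "down \<phi> = {\<psi>. (\<psi> \<^bold>\<rightarrow> \<phi>) \<in> T}"

text \<open>Disjointness from \<open>\<chi>\<close> means lying below its negation, so
  \<open>perp (perp X)\<close> consists of the lower bounds of the upper bounds of \<open>X\<close>:
  the regular sets are the cuts. The element given by a formula is its set \<open>down\<close>,
  which avoids a quotient by equivalence modulo \<open>T\<close>.\<close>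

definition perp :: "fm set \<Rightarrow> fm set" where
  "perp X = {\<psi>. \<forall>\<chi>\<in>X. \<^bold>\<not> (\<psi> \<^bold>\<and> \<chi>) \<in> T}"

abbreviation regular :: "fm set \<Rightarrow> bool" where
  "regular X \<equiv> perp (perp X) = X"

lemma disjoint_sym: "\<^bold>\<not> (\<psi> \<^bold>\<and> \<chi>) \<in> T \<Longrightarrow> \<^bold>\<not> (\<chi> \<^bold>\<and> \<psi>) \<in> T"
  by (erule mem_consequence1) auto

lemma perp_antimono: "X \<subseteq> Y \<Longrightarrow> perp Y \<subseteq> perp X"
  unfolding perp_def by blast

lemma perp_perp_subset: "X \<subseteq> perp (perp X)"
  unfolding perp_def using disjoint_sym by blast

lemma regular_perp: "regular (perp X)"
  using perp_perp_subset[of "perp X"] perp_antimono[OF perp_perp_subset[of X]] by blast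

lemma perp_perp_least: "X \<subseteq> Y \<Longrightarrow> regular Y \<Longrightarrow> perp (perp X) \<subseteq> Y"
  using perp_antimono by metis

lemma regular_Inter:
  assumes "\<And>X. X \<in> \<X> \<Longrightarrow> regular X"
  shows "regular (\<Inter>\<X>)"
proof
  show "perp (perp (\<Inter>\<X>)) \<subseteq> \<Inter>\<X>"
    using perp_perp_least[of "\<Inter>\<X>"] assms by (meson Inter_greatest Inter_lower)
qed (rule perp_perp_subset)

lemma regular_Int: "regular X \<Longrightarrow> regular Y \<Longrightarrow> regular (X \<inter> Y)"
  using regular_Inter[of "{X, Y}"] by auto

lemma perp_down_closed: "\<phi> \<in> perp X \<Longrightarrow> (\<psi> \<^bold>\<rightarrow> \<phi>) \<in> T \<Longrightarrow> \<psi> \<in> perp X"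
  unfolding perp_def mem_Collect_eq
proof
  fix \<chi> assume "\<forall>\<chi>\<in>X. \<^bold>\<not> (\<phi> \<^bold>\<and> \<chi>) \<in> T" "\<chi> \<in> X" and imp: "(\<psi> \<^bold>\<rightarrow> \<phi>) \<in> T"
  then have "\<^bold>\<not> (\<phi> \<^bold>\<and> \<chi>) \<in> T" by blast
  with imp show "\<^bold>\<not> (\<psi> \<^bold>\<and> \<chi>) \<in> T" by (rule mem_consequence2) auto
qed

lemma regular_down_closed: "regular X \<Longrightarrow> \<phi> \<in> X \<Longrightarrow> (\<psi> \<^bold>\<rightarrow> \<phi>) \<in> T \<Longrightarrow> \<psi> \<in> X"
  using perp_down_closed[of \<phi> "perp X"] by simp

lemma perp_Disj: "\<phi> \<in> perp X \<Longrightarrow> \<psi> \<in> perp X \<Longrightarrow> \<phi> \<^bold>\<or> \<psi> \<in> perp X"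
  unfolding perp_def
proof (clarify)
  fix \<chi> assume "\<forall>\<chi>\<in>X. \<^bold>\<not> (\<phi> \<^bold>\<and> \<chi>) \<in> T" "\<forall>\<chi>\<in>X. \<^bold>\<not> (\<psi> \<^bold>\<and> \<chi>) \<in> T" "\<chi> \<in> X"
  then have "\<^bold>\<not> (\<phi> \<^bold>\<and> \<chi>) \<in> T" "\<^bold>\<not> (\<psi> \<^bold>\<and> \<chi>) \<in> T" by auto
  then show "\<^bold>\<not> ((\<phi> \<^bold>\<or> \<psi>) \<^bold>\<and> \<chi>) \<in> T" by (rule mem_consequence2) auto
qed

lemma regular_Disj: "regular X \<Longrightarrow> \<phi> \<in> X \<Longrightarrow> \<psi> \<in> X \<Longrightarrow> \<phi> \<^bold>\<or> \<psi> \<in> X"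
  using perp_Disj[of \<phi> "perp X" \<psi>] by simp

lemma down_refl: "\<phi> \<in> down \<phi>"
  unfolding down_def by (auto intro: mem_consequence0)

lemma mem_down_Bot: "\<phi> \<in> down \<^bold>\<bottom> \<longleftrightarrow> \<^bold>\<not> \<phi> \<in> T"
  unfolding down_def mem_Collect_eq by (rule iffI; erule mem_consequence1; simp)

lemma down_mono: "(\<phi> \<^bold>\<rightarrow> \<psi>) \<in> T \<Longrightarrow> down \<phi> \<subseteq> down \<psi>"
  unfolding down_def using Imp_trans by blast

lemma down_subset_iff: "down \<phi> \<subseteq> down \<psi> \<longleftrightarrow> (\<phi> \<^bold>\<rightarrow> \<psi>) \<in> T"
  using down_mono down_refl[of \<phi>] by (auto simp: down_def)

lemma down_cong: "(\<And>g. pval g \<phi> \<longleftrightarrow> pval g \<psi>) \<Longrightarrow> down \<phi> = down \<psi>"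
  by (intro equalityI down_mono mem_consequence0) auto

lemma perp_down: "perp (down \<phi>) = down (\<^bold>\<not> \<phi>)"
proof
  show "perp (down \<phi>) \<subseteq> down (\<^bold>\<not> \<phi>)"
  proof
    fix \<psi> assume "\<psi> \<in> perp (down \<phi>)"
    then have "\<^bold>\<not> (\<psi> \<^bold>\<and> \<phi>) \<in> T" using down_refl unfolding perp_def by blast
    then have "(\<psi> \<^bold>\<rightarrow> \<^bold>\<not> \<phi>) \<in> T" by (rule mem_consequence1) auto
    then show "\<psi> \<in> down (\<^bold>\<not> \<phi>)" by (simp add: down_def)
  qed
  show "down (\<^bold>\<not> \<phi>) \<subseteq> perp (down \<phi>)"
    unfolding perp_def down_def
  proof clarify
    fix \<psi> \<chi> assume "(\<psi> \<^bold>\<rightarrow> \<^bold>\<not> \<phi>) \<in> T" "(\<chi> \<^bold>\<rightarrow> \<phi>) \<in> T"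
    then show "\<^bold>\<not> (\<psi> \<^bold>\<and> \<chi>) \<in> T" by (rule mem_consequence2) auto
  qed
qed

lemma regular_down: "regular (down \<phi>)"
  using down_cong[of "\<^bold>\<not> \<^bold>\<not> \<phi>" \<phi>] by (simp add: perp_down)

lemma down_Top: "down \<^bold>\<top> = UNIV"
  unfolding down_def by (auto intro: mem_consequence0)

lemma perp_UNIV: "perp UNIV = down \<^bold>\<bottom>"
  using perp_down[of "\<^bold>\<top>"] down_cong[of "\<^bold>\<not> \<^bold>\<top>" "\<^bold>\<bottom>"] by (simp add: down_Top)

lemma regular_UNIV: "regular UNIV"
  using regular_down[of "\<^bold>\<top>"] by (simp add: down_Top)

text \<open>Formulas refuted by \<open>T\<close> are disjoint from everything. Hence the least
  regular set is \<open>down\<close> of bottom and not the empty set.\<close>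

lemma down_Bot_subset: "regular X \<Longrightarrow> down \<^bold>\<bottom> \<subseteq> X"
  using perp_antimono[of "perp X" UNIV] by (simp add: perp_UNIV)

lemma down_Conj: "down (\<phi> \<^bold>\<and> \<psi>) = down \<phi> \<inter> down \<psi>"
proof
  show "down (\<phi> \<^bold>\<and> \<psi>) \<subseteq> down \<phi> \<inter> down \<psi>"
    by (intro Int_greatest down_mono mem_consequence0) auto
  show "down \<phi> \<inter> down \<psi> \<subseteq> down (\<phi> \<^bold>\<and> \<psi>)"
    unfolding down_def
  proof clarify
    fix \<chi> assume "(\<chi> \<^bold>\<rightarrow> \<phi>) \<in> T" "(\<chi> \<^bold>\<rightarrow> \<psi>) \<in> T"
    then show "(\<chi> \<^bold>\<rightarrow> \<phi> \<^bold>\<and> \<psi>) \<in> T" by (rule mem_consequence2) auto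
  qed
qed

lemma perp_Un: "perp (X \<union> Y) = perp X \<inter> perp Y"
  unfolding perp_def by blast

lemma down_Disj: "perp (perp (down \<phi> \<union> down \<psi>)) = down (\<phi> \<^bold>\<or> \<psi>)"
proof -
  have "perp (perp (down \<phi> \<union> down \<psi>)) = down (\<^bold>\<not> (\<^bold>\<not> \<phi> \<^bold>\<and> \<^bold>\<not> \<psi>))"
    by (simp only: perp_Un perp_down down_Conj[symmetric])
  also have "\<dots> = down (\<phi> \<^bold>\<or> \<psi>)" by (rule down_cong) simp
  finally show ?thesis .
qed

lemma Int_perp: "X \<inter> perp X \<subseteq> down \<^bold>\<bottom>"
proof
  fix \<phi> assume "\<phi> \<in> X \<inter> perp X"
  then have "\<^bold>\<not> (\<phi> \<^bold>\<and> \<phi>) \<in> T" unfolding perp_def by blast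
  then have "\<^bold>\<not> \<phi> \<in> T" by (rule mem_consequence1) auto
  then show "\<phi> \<in> down \<^bold>\<bottom>" by (simp add: mem_down_Bot)
qed

lemma regular_Int_perp: "regular X \<Longrightarrow> X \<inter> perp X = down \<^bold>\<bottom>"
  using Int_perp down_Bot_subset[of X] down_Bot_subset[of "perp X"] regular_perp by blast

lemma perp_perp_Un_perp: "perp (perp (X \<union> perp X)) = UNIV"
proof -
  have "perp (X \<union> perp X) = down \<^bold>\<bottom>"
    using regular_Int_perp[OF regular_perp, of X] by (simp add: perp_Un)
  then show ?thesis using perp_UNIV regular_UNIV by simp
qed

text \<open>For the inclusion from left to right let \<open>\<chi>\<close> be disjoint from both
  intersections. For \<open>\<psi>\<close> in \<open>Y\<close> or \<open>Z\<close> the conjunction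
  of \<open>\<phi>\<close> and \<open>\<psi>\<close> lies in one of them, so the conjunction of
  \<open>\<phi>\<close> and \<open>\<chi>\<close> is disjoint from \<open>\<psi>\<close>. It
  therefore lies in \<open>perp (Y \<union> Z)\<close>, from which \<open>\<phi>\<close> is
  disjoint.\<close>

lemma regular_Int_join_distrib:
  assumes "regular X" "regular Y" "regular Z"
  shows "X \<inter> perp (perp (Y \<union> Z)) = perp (perp (X \<inter> Y \<union> X \<inter> Z))"
proof
  show "X \<inter> perp (perp (Y \<union> Z)) \<subseteq> perp (perp (X \<inter> Y \<union> X \<inter> Z))"
  proof
    fix \<phi> assume \<phi>: "\<phi> \<in> X \<inter> perp (perp (Y \<union> Z))"
    have "\<^bold>\<not> (\<phi> \<^bold>\<and> \<chi>) \<in> T" if \<chi>: "\<chi> \<in> perp (X \<inter> Y \<union> X \<inter> Z)" for \<chi>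
    proof -
      have "\<^bold>\<not> ((\<phi> \<^bold>\<and> \<chi>) \<^bold>\<and> \<psi>) \<in> T" if \<psi>: "\<psi> \<in> Y \<union> Z" for \<psi>
      proof -
        have "(\<phi> \<^bold>\<and> \<psi> \<^bold>\<rightarrow> \<phi>) \<in> T" "(\<phi> \<^bold>\<and> \<psi> \<^bold>\<rightarrow> \<psi>) \<in> T" by (rule mem_consequence0; simp)+
        then have "\<phi> \<^bold>\<and> \<psi> \<in> X \<inter> Y \<union> X \<inter> Z"
          using \<phi> \<psi> assms regular_down_closed by blast
        with \<chi> have "\<^bold>\<not> (\<chi> \<^bold>\<and> (\<phi> \<^bold>\<and> \<psi>)) \<in> T" unfolding perp_def by blast
        then show ?thesis by (rule mem_consequence1) auto
      qed
      then have "\<phi> \<^bold>\<and> \<chi> \<in> perp (Y \<union> Z)" unfolding perp_def by blast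
      with \<phi> have "\<^bold>\<not> (\<phi> \<^bold>\<and> (\<phi> \<^bold>\<and> \<chi>)) \<in> T" unfolding perp_def[of "perp (Y \<union> Z)"] by blast
      then show ?thesis by (rule mem_consequence1) auto
    qed
    then show "\<phi> \<in> perp (perp (X \<inter> Y \<union> X \<inter> Z))" unfolding perp_def[of "perp _"] by blast
  qed
  show "perp (perp (X \<inter> Y \<union> X \<inter> Z)) \<subseteq> X \<inter> perp (perp (Y \<union> Z))"
    using assms regular_Int[OF assms(1) regular_perp, of "perp (Y \<union> Z)"]
      perp_perp_subset[of "Y \<union> Z"]
    by (intro perp_perp_least) auto
qed

section \<open>Relation and diamond on the completion\<close>

definition cprec :: "fm set \<Rightarrow> fm set \<Rightarrow> bool" where
  "cprec X Y \<longleftrightarrow> (\<exists>\<phi> \<psi>. X \<subseteq> down \<phi> \<and> (\<phi> \<leadsto> \<psi>) \<in> T \<and> \<psi> \<in> Y)"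

text \<open>The largest monotone extension of \<open>Dia\<close> from formulas to cuts: a monotone
  extension has to stay below each of the sets intersected here.\<close>

definition cdia :: "fm set \<Rightarrow> fm set" where
  "cdia X = (\<Inter>\<psi>\<in>{\<psi>. X \<subseteq> down \<psi>}. down (Dia \<psi>))"

lemma cprecI: "X \<subseteq> down \<phi> \<Longrightarrow> (\<phi> \<leadsto> \<psi>) \<in> T \<Longrightarrow> \<psi> \<in> Y \<Longrightarrow> cprec X Y"
  unfolding cprec_def by blast

lemma cprecE:
  assumes "cprec X Y"
  obtains \<phi> \<psi> where "X \<subseteq> down \<phi>" "(\<phi> \<leadsto> \<psi>) \<in> T" "\<psi> \<in> Y"
  using assms unfolding cprec_def by blast

lemma cprec_down: "cprec (down \<phi>) (down \<psi>) \<longleftrightarrow> (\<phi> \<leadsto> \<psi>) \<in> T"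
proof
  assume "cprec (down \<phi>) (down \<psi>)"
  then obtain \<phi>' \<psi>' where "(\<phi> \<^bold>\<rightarrow> \<phi>') \<in> T" "(\<phi>' \<leadsto> \<psi>') \<in> T" "(\<psi>' \<^bold>\<rightarrow> \<psi>) \<in> T"
    unfolding cprec_def down_subset_iff by (auto simp: down_def)
  then show "(\<phi> \<leadsto> \<psi>) \<in> T" using SImp_mono by blast
qed (blast intro: cprecI down_refl)

lemma cprec_Int:
  assumes "cprec X Y" "cprec X Z" "regular Y" "regular Z"
  shows "cprec X (Y \<inter> Z)"
proof -
  obtain \<phi> \<psi> where 1: "X \<subseteq> down \<phi>" "(\<phi> \<leadsto> \<psi>) \<in> T" "\<psi> \<in> Y" using assms(1) by (rule cprecE)
  obtain \<phi>' \<psi>' where 2: "X \<subseteq> down \<phi>'" "(\<phi>' \<leadsto> \<psi>') \<in> T" "\<psi>' \<in> Z" using assms(2) by (rule cprecE)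
  have "(\<psi> \<^bold>\<and> \<psi>' \<^bold>\<rightarrow> \<psi>) \<in> T" "(\<psi> \<^bold>\<and> \<psi>' \<^bold>\<rightarrow> \<psi>') \<in> T" by (rule mem_consequence0; simp)+
  then have "\<psi> \<^bold>\<and> \<psi>' \<in> Y \<inter> Z" using 1 2 assms regular_down_closed by blast
  then show ?thesis
    using 1(1) 2(1) by (intro cprecI[OF _ SImp_Conj[OF 1(2) 2(2)]]) (auto simp: down_Conj)
qed

lemma cprec_join:
  assumes "cprec X Z" "cprec Y Z" "regular Z"
  shows "cprec (perp (perp (X \<union> Y))) Z"
proof -
  obtain \<phi> \<psi> where 1: "X \<subseteq> down \<phi>" "(\<phi> \<leadsto> \<psi>) \<in> T" "\<psi> \<in> Z" using assms(1) by (rule cprecE)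
  obtain \<phi>' \<psi>' where 2: "Y \<subseteq> down \<phi>'" "(\<phi>' \<leadsto> \<psi>') \<in> T" "\<psi>' \<in> Z" using assms(2) by (rule cprecE)
  have "perp (perp (X \<union> Y)) \<subseteq> perp (perp (down \<phi> \<union> down \<phi>'))"
    using 1(1) 2(1) by (intro perp_antimono) blast
  then show ?thesis
    using 1(3) 2(3) assms(3)
    by (intro cprecI[OF _ SImp_Disj[OF 1(2) 2(2)]]) (auto simp: down_Disj regular_Disj)
qed

lemma cprec_subset: "cprec X Y \<Longrightarrow> regular Y \<Longrightarrow> X \<subseteq> Y"
proof (erule cprecE)
  fix \<phi> \<psi> assume 1: "X \<subseteq> down \<phi>" "(\<phi> \<leadsto> \<psi>) \<in> T" "\<psi> \<in> Y" and Y: "regular Y"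
  have "down \<phi> \<subseteq> down \<psi>" by (rule down_mono[OF SImp_imp_mem[OF 1(2)]])
  moreover have "down \<psi> \<subseteq> Y" using regular_down_closed[OF Y 1(3)] by (auto simp: down_def)
  ultimately show "X \<subseteq> Y" using 1(1) by blast
qed

lemma cprec_perp:
  assumes "cprec X Y"
  shows "cprec (perp Y) (perp X)"
proof -
  obtain \<phi> \<psi> where 1: "X \<subseteq> down \<phi>" "(\<phi> \<leadsto> \<psi>) \<in> T" "\<psi> \<in> Y" using assms by (rule cprecE)
  have "perp Y \<subseteq> down (\<^bold>\<not> \<psi>)"
  proof
    fix \<chi> assume "\<chi> \<in> perp Y"
    then have "\<^bold>\<not> (\<chi> \<^bold>\<and> \<psi>) \<in> T" using 1(3) unfolding perp_def by blast
    then have "(\<chi> \<^bold>\<rightarrow> \<^bold>\<not> \<psi>) \<in> T" by (rule mem_consequence1) auto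
    then show "\<chi> \<in> down (\<^bold>\<not> \<psi>)" by (simp add: down_def)
  qed
  moreover have "\<^bold>\<not> \<phi> \<in> perp X"
    using perp_antimono[OF 1(1)] down_refl[of "\<^bold>\<not> \<phi>"] by (auto simp: perp_down)
  ultimately show ?thesis using 1(2) SImp_contrapos by (intro cprecI) auto
qed

lemma cprec_interpolate:
  assumes "cprec X Y"
  shows "\<exists>Z. regular Z \<and> cprec X Z \<and> cprec Z Y"
proof -
  obtain \<phi> \<psi> where 1: "X \<subseteq> down \<phi>" "(\<phi> \<leadsto> \<psi>) \<in> T" "\<psi> \<in> Y" using assms by (rule cprecE)
  obtain \<chi> where "(\<phi> \<leadsto> \<chi>) \<in> T" "(\<chi> \<leadsto> \<psi>) \<in> T" using SImp_witness[OF 1(2)] by blast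
  then show ?thesis
    using 1 regular_down[of \<chi>] down_refl[of \<chi>] cprecI[of X \<phi> \<chi> "down \<chi>"]
      cprecI[of "down \<chi>" \<chi> \<psi> Y] by blast
qed

lemma cprec_nonzero:
  assumes "regular X" "X \<noteq> down \<^bold>\<bottom>"
  shows "\<exists>Y. regular Y \<and> Y \<noteq> down \<^bold>\<bottom> \<and> cprec Y X"
proof -
  obtain \<phi> where \<phi>: "\<phi> \<in> X" "\<phi> \<notin> down \<^bold>\<bottom>" using assms down_Bot_subset by blast
  then have "\<^bold>\<not> \<phi> \<notin> T" by (simp add: mem_down_Bot)
  then obtain \<chi> where \<chi>: "(\<chi> \<leadsto> \<phi>) \<in> T" "\<^bold>\<not> \<chi> \<notin> T" using nonzero_witness by blast
  have "down \<chi> \<noteq> down \<^bold>\<bottom>"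
    using down_refl[of \<chi>] \<chi>(2) by (auto simp: mem_down_Bot)
  then show ?thesis using cprecI[OF subset_refl \<chi>(1) \<phi>(1)] regular_down by blast
qed

lemma regular_cdia: "regular (cdia X)"
  unfolding cdia_def by (rule regular_Inter) (auto simp: regular_down)

lemma cdia_mono: "X \<subseteq> Y \<Longrightarrow> cdia X \<subseteq> cdia Y"
  unfolding cdia_def by blast

lemma cdia_down: "cdia (down \<phi>) = down (Dia \<phi>)"
  unfolding cdia_def using down_mono[OF Dia_mono] down_subset_iff by blast

lemma cdia_Bot: "cdia (down \<^bold>\<bottom>) = down \<^bold>\<bottom>"
  using down_mono[OF Dia_Bot] down_Bot_subset[OF regular_down] by (simp add: cdia_down) blast

lemma Dia_mem_cdia: "\<phi> \<in> X \<Longrightarrow> Dia \<phi> \<in> cdia X"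
  unfolding cdia_def by (auto simp: down_def intro!: Dia_mono)

text \<open>The related pair of formulas is formed from disjunctions: the disjunction of
  \<open>Dia \<phi>\<close> and \<open>Dia \<phi>'\<close> bounds the left cut because
  \<open>Dia\<close> is additive on formulas, and \<open>Dia \<psi>\<close>,
  \<open>Dia \<psi>'\<close> belong to the diamonds on the right.\<close>

lemma cdia_additive:
  assumes "cprec X1 Y1" "cprec X2 Y2"
  shows "cprec (cdia (perp (perp (X1 \<union> X2)))) (perp (perp (cdia Y1 \<union> cdia Y2)))"
proof -
  obtain \<phi> \<psi> where 1: "X1 \<subseteq> down \<phi>" "(\<phi> \<leadsto> \<psi>) \<in> T" "\<psi> \<in> Y1" using assms(1) by (rule cprecE)
  obtain \<phi>' \<psi>' where 2: "X2 \<subseteq> down \<phi>'" "(\<phi>' \<leadsto> \<psi>') \<in> T" "\<psi>' \<in> Y2" using assms(2) by (rule cprecE)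
  have "perp (perp (X1 \<union> X2)) \<subseteq> perp (perp (down \<phi> \<union> down \<phi>'))"
    using 1(1) 2(1) by (intro perp_antimono) blast
  then have "cdia (perp (perp (X1 \<union> X2))) \<subseteq> down (Dia (\<phi> \<^bold>\<or> \<phi>'))"
    using cdia_mono[of _ "down (\<phi> \<^bold>\<or> \<phi>')"] by (simp add: down_Disj cdia_down)
  also have "\<dots> \<subseteq> down (Dia \<phi> \<^bold>\<or> Dia \<phi>')" by (rule down_mono[OF Dia_Disj])
  finally show ?thesis
  proof (rule cprecI)
    show "(Dia \<phi> \<^bold>\<or> Dia \<phi>' \<leadsto> Dia \<psi> \<^bold>\<or> Dia \<psi>') \<in> T"
      using 1(2) 2(2) by (intro SImp_Disj Dia_SImp)
    show "Dia \<psi> \<^bold>\<or> Dia \<psi>' \<in> perp (perp (cdia Y1 \<union> cdia Y2))"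
      using 1(3) 2(3) perp_perp_subset[of "cdia Y1 \<union> cdia Y2"]
      by (intro perp_Disj) (auto dest: Dia_mem_cdia)
  qed
qed

text \<open>Suppose \<open>\<zeta>\<close> is not below \<open>Dia \<psi>\<close> for some
  \<open>\<psi>\<close> above \<open>X\<close>. Then \<open>Box_witness\<close> gives a
  \<open>\<chi>\<close> that strictly implies the negation of \<open>\<psi>\<close> and whose box is
  not below the negation of \<open>\<zeta>\<close>. Contraposition puts \<open>X\<close> in relation
  to the negation of \<open>\<chi>\<close>, and the hypothesis for this cut contradicts the choice
  of \<open>\<chi>\<close>.\<close>

lemma cdia_upper_continuous:
  assumes "\<And>Y. regular Y \<Longrightarrow> cprec X Y \<Longrightarrow> Z \<subseteq> cdia Y"
  shows "Z \<subseteq> cdia X"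
proof
  fix \<zeta> assume \<zeta>: "\<zeta> \<in> Z"
  have "(\<zeta> \<^bold>\<rightarrow> Dia \<psi>) \<in> T" if X: "X \<subseteq> down \<psi>" for \<psi>
  proof (rule ccontr)
    assume "(\<zeta> \<^bold>\<rightarrow> Dia \<psi>) \<notin> T"
    then have "(\<^bold>\<box> (\<^bold>\<not> \<psi>) \<^bold>\<rightarrow> \<^bold>\<not> \<zeta>) \<notin> T"
      by (rule contrapos_nn) (erule mem_consequence1, auto)
    then obtain \<chi> where \<chi>: "(\<chi> \<leadsto> \<^bold>\<not> \<psi>) \<in> T" "(\<^bold>\<box> \<chi> \<^bold>\<rightarrow> \<^bold>\<not> \<zeta>) \<notin> T"
      using Box_witness by blast
    have "(\<^bold>\<not> \<^bold>\<not> \<psi> \<leadsto> \<^bold>\<not> \<chi>) \<in> T" using \<chi>(1) SImp_contrapos by blast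
    then have "(\<psi> \<leadsto> \<^bold>\<not> \<chi>) \<in> T" by (rule SImp_left_mono) (auto intro: mem_consequence0)
    then have "cprec X (down (\<^bold>\<not> \<chi>))" using X down_refl by (rule_tac cprecI)
    then have "\<zeta> \<in> cdia (down (\<^bold>\<not> \<chi>))" using assms regular_down \<zeta> by blast
    then have "(\<zeta> \<^bold>\<rightarrow> Dia (\<^bold>\<not> \<chi>)) \<in> T" unfolding cdia_down by (simp add: down_def)
    moreover have "(\<^bold>\<box> \<chi> \<^bold>\<rightarrow> \<^bold>\<box> (\<^bold>\<not> \<^bold>\<not> \<chi>)) \<in> T" by (intro Box_mono mem_consequence0) auto
    ultimately have "(\<^bold>\<box> \<chi> \<^bold>\<rightarrow> \<^bold>\<not> \<zeta>) \<in> T" by (rule mem_consequence2) auto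
    with \<chi>(2) show False ..
  qed
  then show "\<zeta> \<in> cdia X" unfolding cdia_def down_def by blast
qed

section \<open>The completion as an upper continuous modal de Vries algebra\<close>

definition canonical :: "'u univ modal_contact" where
  "canonical = \<lparr>carrier = Inr ` {X. regular X}, eq = (=), le = (\<lambda>x y. projr x \<subseteq> projr y),
     prec = (\<lambda>x y. cprec (projr x) (projr y)), dia = (\<lambda>x. Inr (cdia (projr x)))\<rparr>"

lemma canonical_simps [simp]:
  "carrier canonical = Inr ` {X. regular X}"
  "eq canonical = (=)"
  "le canonical x y \<longleftrightarrow> projr x \<subseteq> projr y"
  "prec canonical x y \<longleftrightarrow> cprec (projr x) (projr y)"
  "dia canonical x = Inr (cdia (projr x))"
  by (simp_all add: canonical_def)

lemma canonical_partial_order: "partial_order canonical"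
  by unfold_locales auto

lemma canonical_glb:
  assumes "A \<subseteq> carrier canonical"
  shows "is_glb canonical (Inr (\<Inter>(projr ` A))) A"
proof (rule greatest_LowerI)
  have "regular X" if "X \<in> projr ` A" for X using that assms by auto
  then have "regular (\<Inter> (projr ` A))" by (rule regular_Inter)
  then show "Inr (\<Inter> (projr ` A)) \<in> carrier canonical" by simp
  fix y assume y: "y \<in> Lower canonical A"
  show "le canonical y (Inr (\<Inter> (projr ` A)))"
    using Lower_memD[OF y _ assms] by auto
qed (use assms in auto)

lemma canonical_lub:
  assumes "A \<subseteq> carrier canonical"
  shows "is_lub canonical (Inr (perp (perp (\<Union>(projr ` A))))) A"
proof (rule least_UpperI)
  show "Inr (perp (perp (\<Union>(projr ` A)))) \<in> carrier canonical"
    using regular_perp by auto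
  show "le canonical x (Inr (perp (perp (\<Union>(projr ` A)))))" if "x \<in> A" for x
    using that perp_perp_subset[of "\<Union>(projr ` A)"] by auto
  fix y assume y: "y \<in> Upper canonical A"
  then have "regular (projr y)" using Upper_closed[of canonical A] by auto
  then have "perp (perp (\<Union>(projr ` A))) \<subseteq> projr y"
    using Upper_memD[OF y _ assms] by (intro perp_perp_least) auto
  then show "le canonical (Inr (perp (perp (\<Union>(projr ` A))))) y" by simp
qed (use assms in auto)

lemma canonical_complete: "complete_lattice canonical"
proof -
  interpret partial_order canonical by (rule canonical_partial_order)
  show ?thesis using canonical_lub canonical_glb by unfold_locales blast+
qed

lemma canonical_meet:
  assumes "regular X" "regular Y"
  shows "Inr X \<sqinter>\<^bsub>canonical\<^esub> Inr Y = Inr (X \<inter> Y)"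
  using partial_order.meet_eqI[OF canonical_partial_order canonical_glb[of "{Inr X, Inr Y}"]] assms
  by auto

lemma canonical_join:
  assumes "regular X" "regular Y"
  shows "Inr X \<squnion>\<^bsub>canonical\<^esub> Inr Y = Inr (perp (perp (X \<union> Y)))"
  using partial_order.join_eqI[OF canonical_partial_order canonical_lub[of "{Inr X, Inr Y}"]] assms
  by auto

lemma canonical_bounded: "bounded_lattice canonical"
proof -
  interpret complete_lattice canonical by (rule canonical_complete)
  show ?thesis by unfold_locales
qed

lemma canonical_top: "\<top>\<^bsub>canonical\<^esub> = Inr UNIV"
  by (rule bounded_lattice.top_eq[OF canonical_bounded, symmetric]) (auto simp: regular_UNIV)

lemma canonical_bottom: "\<bottom>\<^bsub>canonical\<^esub> = Inr (down \<^bold>\<bottom>)"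
proof (rule bounded_lattice.bottom_eq[OF canonical_bounded, symmetric])
  show "Inr (down \<^bold>\<bottom>) \<in> carrier canonical" by (simp add: regular_down)
  show "le canonical (Inr (down \<^bold>\<bottom>)) x" if "x \<in> carrier canonical" for x :: "'a univ"
    using that down_Bot_subset[of "projr x"] by auto
qed

lemma canonical_boolean: "boolean_lattice canonical"
proof -
  interpret bounded_lattice canonical by (rule canonical_bounded)
  show ?thesis
  proof
    fix x y z :: "'a univ"
    assume "x \<in> carrier canonical" "y \<in> carrier canonical" "z \<in> carrier canonical"
    then obtain X Y Z where "x = Inr X" "y = Inr Y" "z = Inr Z" "regular X" "regular Y" "regular Z"
      by auto
    then show "x \<sqinter>\<^bsub>canonical\<^esub> (y \<squnion>\<^bsub>canonical\<^esub> z)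
      = (x \<sqinter>\<^bsub>canonical\<^esub> y) \<squnion>\<^bsub>canonical\<^esub> (x \<sqinter>\<^bsub>canonical\<^esub> z)"
      by (simp add: canonical_meet canonical_join regular_Int regular_perp regular_Int_join_distrib)
  next
    fix x :: "'a univ" assume "x \<in> carrier canonical"
    then obtain X where X: "x = Inr X" "regular X" by auto
    then show "\<exists>y\<in>carrier canonical. x \<sqinter>\<^bsub>canonical\<^esub> y = \<bottom>\<^bsub>canonical\<^esub>
      \<and> x \<squnion>\<^bsub>canonical\<^esub> y = \<top>\<^bsub>canonical\<^esub>"
      by (intro bexI[of _ "Inr (perp X)"])
        (auto simp: canonical_meet canonical_join canonical_top canonical_bottom regular_perp
          regular_Int_perp perp_perp_Un_perp)
  qed
qed

lemma canonical_compl: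
  assumes "regular X"
  shows "\<sim>\<^bsub>canonical\<^esub> (Inr X) = Inr (perp X)"
  using assms by (intro boolean_lattice.compl_eqI[OF canonical_boolean])
    (auto simp: canonical_meet canonical_join canonical_top canonical_bottom regular_perp
          regular_Int_perp perp_perp_Un_perp)

lemma canonical_UMDV: "upper_continuous_modal_de_Vries_algebra canonical"
proof -
  interpret boolean_lattice canonical by (rule canonical_boolean)
  interpret complete_lattice canonical by (rule canonical_complete)
  note ops = canonical_meet canonical_join canonical_top canonical_bottom canonical_compl
    regular_perp regular_cdia regular_down regular_Int
  show ?thesis
  proof
    show "prec canonical \<bottom>\<^bsub>canonical\<^esub> \<bottom>\<^bsub>canonical\<^esub>"
      by (simp add: ops cprec_down Bot_SImp)
    show "prec canonical \<top>\<^bsub>canonical\<^esub> \<top>\<^bsub>canonical\<^esub>"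
      using cprec_down[of "\<^bold>\<top>" "\<^bold>\<top>"] by (simp add: ops down_Top SImp_Top)
    show "dia canonical \<bottom>\<^bsub>canonical\<^esub> = \<bottom>\<^bsub>canonical\<^esub>"
      by (simp add: ops cdia_Bot)
  next
    fix a b c :: "'a univ"
    assume "a \<in> carrier canonical" "b \<in> carrier canonical" "c \<in> carrier canonical"
      "prec canonical a b" "prec canonical a c"
    then show "prec canonical a (b \<sqinter>\<^bsub>canonical\<^esub> c)"
      by (auto simp: ops intro: cprec_Int)
  next
    fix a b c :: "'a univ"
    assume "a \<in> carrier canonical" "b \<in> carrier canonical" "c \<in> carrier canonical"
      "prec canonical a c" "prec canonical b c"
    then show "prec canonical (a \<squnion>\<^bsub>canonical\<^esub> b) c"
      by (auto simp: ops intro: cprec_join)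
  next
    fix a b c d :: "'a univ"
    assume "le canonical a b" "prec canonical b c" "le canonical c d"
    then show "prec canonical a d" by (auto simp: cprec_def)
  next
    fix a b :: "'a univ"
    assume ab: "a \<in> carrier canonical" "b \<in> carrier canonical" "prec canonical a b"
    then show "le canonical a b" using cprec_subset[of "projr a" "projr b"] by auto
    show "prec canonical (\<sim>\<^bsub>canonical\<^esub> b) (\<sim>\<^bsub>canonical\<^esub> a)"
      using ab by (auto simp: ops intro: cprec_perp)
    show "\<exists>c\<in>carrier canonical. prec canonical a c \<and> prec canonical c b"
      using ab cprec_interpolate[of "projr a" "projr b"] by auto
  next
    fix a :: "'a univ"
    assume "a \<in> carrier canonical" "a \<noteq> \<bottom>\<^bsub>canonical\<^esub>"
    then obtain X where X: "a = Inr X" "regular X" "X \<noteq> down \<^bold>\<bottom>"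
      by (auto simp: canonical_bottom)
    obtain Y where "regular Y" "Y \<noteq> down \<^bold>\<bottom>" "cprec Y X"
      using cprec_nonzero[OF X(2,3)] by blast
    then show "\<exists>b\<in>carrier canonical. b \<noteq> \<bottom>\<^bsub>canonical\<^esub> \<and> prec canonical b a"
      using X(1) by (intro bexI[of _ "Inr Y"]) (simp_all add: canonical_bottom)
  next
    fix a :: "'a univ"
    assume a: "a \<in> carrier canonical"
    then show "dia canonical a \<in> carrier canonical" by (simp add: regular_cdia)
    show "is_glb canonical (dia canonical a)
        {dia canonical b |b. b \<in> carrier canonical \<and> prec canonical a b}" (is "is_glb _ _ ?D")
    proof (rule greatest_LowerI)
      have D: "?D \<subseteq> carrier canonical" using regular_cdia by auto
      show "?D \<subseteq> carrier canonical" by (rule D)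
      show "dia canonical a \<in> carrier canonical" by (simp add: regular_cdia)
      show "le canonical (dia canonical a) x" if x: "x \<in> ?D" for x
      proof -
        obtain Y where Y: "x = Inr (cdia Y)" "regular Y" "cprec (projr a) Y" using x by auto
        from cdia_mono[OF cprec_subset[OF Y(3,2)]] Y(1) show ?thesis by simp
      qed
      fix y assume y: "y \<in> Lower canonical ?D"
      have "projr y \<subseteq> cdia Y" if "regular Y" "cprec (projr a) Y" for Y
      proof -
        have "Inr Y \<in> carrier canonical \<and> prec canonical a (Inr Y)" using that by simp
        then have "dia canonical (Inr Y) \<in> ?D" by blast
        from Lower_memD[OF y this D] show ?thesis by simp
      qed
      then show "le canonical y (dia canonical a)"
        using cdia_upper_continuous[of "projr a" "projr y"] by simp
    qed
  next
    fix a\<^sub>1 b\<^sub>1 a\<^sub>2 b\<^sub>2 :: "'a univ"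
    assume "a\<^sub>1 \<in> carrier canonical" "b\<^sub>1 \<in> carrier canonical" "a\<^sub>2 \<in> carrier canonical"
      "b\<^sub>2 \<in> carrier canonical" "prec canonical a\<^sub>1 b\<^sub>1" "prec canonical a\<^sub>2 b\<^sub>2"
    then show "prec canonical (dia canonical (a\<^sub>1 \<squnion>\<^bsub>canonical\<^esub> a\<^sub>2))
        (dia canonical b\<^sub>1 \<squnion>\<^bsub>canonical\<^esub> dia canonical b\<^sub>2)"
      by (auto simp: ops intro: cdia_additive)
  qed
qed

section \<open>The canonical valuation\<close>

lemma down_eq_UNIV_iff: "down \<phi> = UNIV \<longleftrightarrow> \<phi> \<in> T"
proof -
  have "(\<^bold>\<top> \<^bold>\<rightarrow> \<phi>) \<in> T \<longleftrightarrow> \<phi> \<in> T"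
    by (rule Iff_mem[OF mem_consequence0]) simp
  then show ?thesis using down_subset_iff[of "\<^bold>\<top>" \<phi>] by (auto simp: down_Top)
qed

lemma canonical_down:
  "\<sim>\<^bsub>canonical\<^esub> (Inr (down \<phi>)) = Inr (down (\<^bold>\<not> \<phi>))"
  "Inr (down \<phi>) \<sqinter>\<^bsub>canonical\<^esub> Inr (down \<psi>) = Inr (down (\<phi> \<^bold>\<and> \<psi>))"
  "Inr (down \<phi>) \<squnion>\<^bsub>canonical\<^esub> Inr (down \<psi>) = Inr (down (\<phi> \<^bold>\<or> \<psi>))"
  "dia canonical (Inr (down \<phi>)) = Inr (down (Dia \<phi>))"
  by (simp_all only: canonical_compl[OF regular_down] canonical_meet[OF regular_down regular_down]
      canonical_join[OF regular_down regular_down] perp_down down_Conj down_Disj canonical_simps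
      sum.sel cdia_down)

text \<open>The truth lemma. A strict implication outside \<open>T\<close> is refuted by
  \<open>SImp_decided\<close>, so its set \<open>down\<close> is the bottom element, as the
  two-valued semantics requires. For the box, evaluation through the diamond adds double negations
  inside and outside, which disappear modulo \<open>T\<close>.\<close>

lemma val_canonical:
  "val canonical (\<lambda>p. Inr (down (\<sigma> p))) \<phi> = Inr (down (subst \<sigma> \<phi>))"
proof (induction \<phi>)
  case (SImp \<phi> \<psi>)
  let ?\<alpha> = "subst \<sigma> \<phi> \<leadsto> subst \<sigma> \<psi>"
  show ?case
  proof (cases "?\<alpha> \<in> T")
    case True
    then show ?thesis
      using SImp down_eq_UNIV_iff[of ?\<alpha>] by (simp add: cprec_down canonical_top)
  next
    case False
    have "(?\<alpha> \<^bold>\<rightarrow> \<^bold>\<bottom>) \<in> T" using SImp_decided[OF False] by (rule mem_consequence1) auto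
    then have "down ?\<alpha> = down \<^bold>\<bottom>" using down_mono down_Bot_subset[OF regular_down] by blast
    then show ?thesis using SImp False by (simp add: cprec_down canonical_bottom)
  qed
next
  case (Box \<phi>)
  let ?\<phi> = "subst \<sigma> \<phi>"
  have "(\<^bold>\<box> ?\<phi> \<^bold>\<rightarrow> \<^bold>\<box> (\<^bold>\<not> \<^bold>\<not> ?\<phi>)) \<in> T" "(\<^bold>\<box> (\<^bold>\<not> \<^bold>\<not> ?\<phi>) \<^bold>\<rightarrow> \<^bold>\<box> ?\<phi>) \<in> T"
    by (intro Box_mono mem_consequence0; simp)+
  then have "down (\<^bold>\<box> ?\<phi>) = down (\<^bold>\<box> (\<^bold>\<not> \<^bold>\<not> ?\<phi>))" using down_mono by blast
  also have "\<dots> = down (\<^bold>\<not> Dia (\<^bold>\<not> ?\<phi>))" by (rule down_cong) simp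
  finally show ?case
    using Box by (simp add: canonical_down del: canonical_simps)
next
  case (Imp \<phi> \<psi>)
  then show ?case
    using down_cong[of "\<^bold>\<not> subst \<sigma> \<phi> \<^bold>\<or> subst \<sigma> \<psi>" "subst \<sigma> \<phi> \<^bold>\<rightarrow> subst \<sigma> \<psi>"]
    by (simp add: canonical_down)
next
  case (Iff \<phi> \<psi>)
  have "down ((\<^bold>\<not> subst \<sigma> \<phi> \<^bold>\<or> subst \<sigma> \<psi>) \<^bold>\<and> (\<^bold>\<not> subst \<sigma> \<psi> \<^bold>\<or> subst \<sigma> \<phi>)) =
      down (subst \<sigma> \<phi> \<^bold>\<leftrightarrow> subst \<sigma> \<psi>)"
    by (rule down_cong) auto
  then show ?case using Iff by (simp add: canonical_down)
qed (simp_all add: canonical_top canonical_bottom canonical_down down_Top)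

lemma val_canonical_top:
  "val canonical (\<lambda>p. Inr (down (\<sigma> p))) \<phi> = \<top>\<^bsub>canonical\<^esub> \<longleftrightarrow> subst \<sigma> \<phi> \<in> T"
  by (simp add: val_canonical canonical_top down_eq_UNIV_iff)

end

lemma entails_imp_derives:
  assumes "entails (UMDV :: 'u univ modal_contact set) \<Gamma> \<phi>"
  shows "\<Gamma> \<turnstile>\<^sub>u \<phi>"
proof (rule ccontr)
  assume "\<not> \<Gamma> \<turnstile>\<^sub>u \<phi>"
  then obtain T \<sigma> where "saturated_theory T" and T: "\<forall>\<gamma>\<in>\<Gamma>. subst \<sigma> \<gamma> \<in> T" "subst \<sigma> \<phi> \<notin> T"
    using exists_saturated_countertheory by blast
  interpret saturated_theory T by fact
  have "range (\<lambda>p. Inr (down (\<sigma> p))) \<subseteq> carrier canonical" by (auto simp: regular_down)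
  moreover have "(canonical :: 'u univ modal_contact) \<in> UMDV"
    by (simp add: UMDV_def canonical_UMDV)
  ultimately show False
    using assms T unfolding entails_def by (metis val_canonical_top)
qed

theorem theorem3p14:
  fixes \<Gamma> :: "fm set" and \<phi> :: fm
  shows "\<Gamma> \<turnstile>\<^sub>u \<phi> \<longleftrightarrow> entails (UMDV :: 'u univ modal_contact set) \<Gamma> \<phi>"
  using derives_imp_entails entails_imp_derives by blast

end
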